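(* Let $i\in\{1,2\}$ and $u\in\mathbb C^2$. For $v\in\mathbb C$ the following conditions are equivalent: (i) $m_{\mathfrak{sl},i}(v;u)\neq0$; (ii) $m_{\mathfrak{sl},i}(v;u)=\infty$.
   Context: $\mathfrak g_{\mathfrak{sl}}=\mathfrak{sl}(3,\mathbb C)=\mathfrak n_-\oplus\mathfrak a_{\mathfrak{sl}}\oplus\mathfrak n_+$ with $\mathfrak a_{\mathfrak{sl}}$ the traceless diagonal matrices, $\mathfrak n_-$ (resp. $\mathfrak n_+$) strictly lower (resp. upper) triangular matrices, $\mathfrak b_{\mathfrak{sl}}=\mathfrak a_{\mathfrak{sl}}\oplus\mathfrak n_+$. For $u\in\mathbb C^2$, $\mathbb C_u$ is the character $z_1(E_{11}-E_{22})+z_2(E_{22}-E_{33})\mapsto u_1z_1+u_2z_2$ of $\mathfrak a_{\mathfrak{sl}}$, with Verma module $M^{\mathfrak g_{\mathfrak{sl}}}_{\mathfrak b_{\mathfrak{sl}}}(u)$. Embeddings $\iota_1(X)=\begin{pmatrix}X&0\\0&0\end{pmatrix}$, $\iota_2(X)=\begin{pmatrix}0&0\\0&X\end{pmatrix}$; $\mathfrak g'_{\mathfrak{sl},i}=\iota_i(\mathfrak{sl}(2,\mathbb C))$, $\mathfrak a'_{\mathfrak{sl},i}=\mathbb C\,\iota_i(E_{11}-E_{22})$, $\mathfrak n'_{i,-}=\mathfrak n_-\cap\mathfrak g'_{\mathfrak{sl},i}$, $\mathfrak b'_{\mathfrak{sl},i}=\mathfrak b_{\mathfrak{sl}}\cap\mathfrak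 g'_{\mathfrak{sl},i}$. For $v\in\mathbb C$, $\mathbb C_v$ is the character $\iota_i(z(E_{11}-E_{22}))\mapsto vz$ of $\mathfrak a'_{\mathfrak{sl},i}$. $m_{\mathfrak{sl},i}(v;u)=\dim_{\mathbb C}\mathrm{Hom}_{\mathfrak a'_{\mathfrak{sl},i}}(\mathbb C_v,\mathbb C_u|_{\mathfrak a'_{\mathfrak{sl},i}}\otimes S(\mathfrak n_-/\mathfrak n_{i,-}'))$, where $S(\cdot)$ is the symmetric algebra with the adjoint action; this is the multiplicity of the Verma module $[M^{\mathfrak g'_{\mathfrak{sl},i}}_{\mathfrak b'_{\mathfrak{sl},i}}(v)]$ in the (formal-character) branching law of $[M^{\mathfrak g_{\mathfrak{sl}}}_{\mathfrak b_{\mathfrak{sl}}}(u)|_{\mathfrak g'_{\mathfrak{sl},i}}]$. *)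

theory Defs
  imports
    "HOL-Analysis.Analysis"
    "HOL-Algebra.QuotRing"
    "HOL-Algebra.Module"
    "HOL-Library.Poly_Mapping"
    "HOL-Library.Extended_Nat"
begin

section \<open>Complex vector spaces with explicit carrier\<close>

text \<open>
  Complex vector spaces are records of HOL-Algebra's type \<open>(complex, 'a) module\<close>.  The two
  multiplicative fields of that record are meaningless for a bare vector space and left unspecified.
\<close>

definition complex_ring :: "complex ring" where
  "complex_ring = \<lparr>carrier = UNIV, monoid.mult = (*), one = 1, zero = 0, add = (+)\<rparr>"

definition vspace_on :: "(complex \<Rightarrow> 'a \<Rightarrow> 'a) \<Rightarrow> 'a::ab_group_add set \<Rightarrow> (complex, 'a) module" where
  "vspace_on s V = \<lparr>carrier = V, monoid.mult = undefined, one = undefined,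
     zero = 0, add = (+), smult = s\<rparr>"

definition submodule_gen :: "(complex, 'a) module \<Rightarrow> 'a set \<Rightarrow> 'a set" where
  "submodule_gen M S = \<Inter>{N. submodule N complex_ring M \<and> S \<subseteq> N}"

text \<open>
  \<open>quot_map M N f\<close> is the map of cosets \<open>N + x \<mapsto> N + f x\<close>; it is meaningful if \<open>f\<close> is additive
  and preserves \<open>N\<close>.  Both the scalar multiplication and the Lie algebra actions on quotients
  are obtained this way.
\<close>

definition quot_map :: "(complex, 'a) module \<Rightarrow> 'a set \<Rightarrow> ('a \<Rightarrow> 'a) \<Rightarrow> 'a set \<Rightarrow> 'a set" where
  "quot_map M N f X = (\<Union>x\<in>X. N +>\<^bsub>M\<^esub> f x)"

definition quot_module :: "(complex, 'a) module \<Rightarrow> 'a set \<Rightarrow> (complex, 'a set) module" where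
  "quot_module M N = \<lparr>carrier = a_rcosets\<^bsub>M\<^esub> N, monoid.mult = rcoset_mult M N,
     one = N +>\<^bsub>M\<^esub> \<one>\<^bsub>M\<^esub>, zero = N, add = set_add M,
     smult = (\<lambda>c. quot_map M N (\<lambda>x. c \<odot>\<^bsub>M\<^esub> x))\<rparr>"

definition finite_basis :: "(complex, 'a) module \<Rightarrow> 'a set \<Rightarrow> bool" where
  "finite_basis M B \<longleftrightarrow> finite B \<and> B \<subseteq> carrier M \<and>
     (\<forall>c. (\<Oplus>\<^bsub>M\<^esub>b\<in>B. c b \<odot>\<^bsub>M\<^esub> b) = \<zero>\<^bsub>M\<^esub> \<longrightarrow> (\<forall>b\<in>B. c b = 0)) \<and>
     (\<forall>x\<in>carrier M. \<exists>c. x = (\<Oplus>\<^bsub>M\<^esub>b\<in>B. c b \<odot>\<^bsub>M\<^esub> b))"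

text \<open>
  All finite bases have the same cardinality, so the infimum below is that common cardinality;
  if there is no finite basis, it is \<open>Inf {} = \<infinity>\<close>.
\<close>

definition module_dim :: "(complex, 'a) module \<Rightarrow> enat" where
  "module_dim M = Inf {enat (card B) | B. finite_basis M B}"


section \<open>Tensor products, symmetric algebras and spaces of homomorphisms\<close>

definition pscale :: "complex \<Rightarrow> ('k \<Rightarrow>\<^sub>0 complex) \<Rightarrow> ('k \<Rightarrow>\<^sub>0 complex)" where
  "pscale c = Poly_Mapping.map ((*) c)"

definition free_module :: "'k set \<Rightarrow> (complex, 'k \<Rightarrow>\<^sub>0 complex) module" where
  "free_module K = vspace_on pscale {p. Poly_Mapping.keys p \<subseteq> K}"

definition tensor_relations ::
  "(complex, 'a) module \<Rightarrow> (complex, 'b) module \<Rightarrow> ('a \<times> 'b \<Rightarrow>\<^sub>0 complex) set" where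
  "tensor_relations M N =
     {Poly_Mapping.single (x \<oplus>\<^bsub>M\<^esub> x', y) 1 - Poly_Mapping.single (x, y) 1 - Poly_Mapping.single (x', y) 1
        | x x' y. x \<in> carrier M \<and> x' \<in> carrier M \<and> y \<in> carrier N} \<union>
     {Poly_Mapping.single (x, y \<oplus>\<^bsub>N\<^esub> y') 1 - Poly_Mapping.single (x, y) 1 - Poly_Mapping.single (x, y') 1
        | x y y'. x \<in> carrier M \<and> y \<in> carrier N \<and> y' \<in> carrier N} \<union>
     {Poly_Mapping.single (c \<odot>\<^bsub>M\<^esub> x, y) 1 - Poly_Mapping.single (x, y) c
        | c x y. x \<in> carrier M \<and> y \<in> carrier N} \<union>
     {Poly_Mapping.single (x, c \<odot>\<^bsub>N\<^esub> y) 1 - Poly_Mapping.single (x, y) c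
        | c x y. x \<in> carrier M \<and> y \<in> carrier N}"

definition tensor_kernel ::
  "(complex, 'a) module \<Rightarrow> (complex, 'b) module \<Rightarrow> ('a \<times> 'b \<Rightarrow>\<^sub>0 complex) set" where
  "tensor_kernel M N = submodule_gen (free_module (carrier M \<times> carrier N)) (tensor_relations M N)"

definition tensor_module ::
  "(complex, 'a) module \<Rightarrow> (complex, 'b) module \<Rightarrow> (complex, ('a \<times> 'b \<Rightarrow>\<^sub>0 complex) set) module" where
  "tensor_module M N = quot_module (free_module (carrier M \<times> carrier N)) (tensor_kernel M N)"

text \<open>
  Given endomorphisms \<open>f\<close> of \<open>M\<close> and \<open>g\<close> of \<open>N\<close> by which a Lie algebra element acts, it acts on the
  tensor product by \<open>x \<otimes> y \<mapsto> f x \<otimes> y + x \<otimes> g y\<close>.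
\<close>

definition tensor_act ::
  "(complex, 'a) module \<Rightarrow> (complex, 'b) module \<Rightarrow> ('a \<Rightarrow> 'a) \<Rightarrow> ('b \<Rightarrow> 'b) \<Rightarrow>
     ('a \<times> 'b \<Rightarrow>\<^sub>0 complex) set \<Rightarrow> ('a \<times> 'b \<Rightarrow>\<^sub>0 complex) set" where
  "tensor_act M N f g =
     quot_map (free_module (carrier M \<times> carrier N)) (tensor_kernel M N)
       (\<lambda>p. \<Sum>(x, y)\<in>Poly_Mapping.keys p.
          Poly_Mapping.single (f x, y) (Poly_Mapping.lookup p (x, y)) +
          Poly_Mapping.single (x, g y) (Poly_Mapping.lookup p (x, y)))"

text \<open>
  The symmetric algebra of \<open>V\<close> is the polynomial algebra in commuting indeterminates \<open>X_v\<close>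
  (\<open>v \<in> V\<close>), modulo the ideal generated by \<open>X_{v+w} - X_v - X_w\<close> and \<open>X_{cv} - c X_v\<close>.
  Monomials are finite multisets of elements of \<open>V\<close>.
\<close>

definition poly_algebra :: "'a set \<Rightarrow> (complex, 'a multiset \<Rightarrow>\<^sub>0 complex) module" where
  "poly_algebra V = \<lparr>carrier = {p. \<forall>m\<in>Poly_Mapping.keys p. set_mset m \<subseteq> V},
     monoid.mult = (*), one = 1, zero = 0, add = (+), smult = pscale\<rparr>"

definition sym_relations :: "(complex, 'a) module \<Rightarrow> ('a multiset \<Rightarrow>\<^sub>0 complex) set" where
  "sym_relations V =
     {Poly_Mapping.single {#v \<oplus>\<^bsub>V\<^esub> w#} 1 - Poly_Mapping.single {#v#} 1 - Poly_Mapping.single {#w#} 1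
        | v w. v \<in> carrier V \<and> w \<in> carrier V} \<union>
     {Poly_Mapping.single {#c \<odot>\<^bsub>V\<^esub> v#} 1 - Poly_Mapping.single {#v#} c | c v. v \<in> carrier V}"

definition sym_ideal :: "(complex, 'a) module \<Rightarrow> ('a multiset \<Rightarrow>\<^sub>0 complex) set" where
  "sym_ideal V = genideal (poly_algebra (carrier V)) (sym_relations V)"

definition sym_algebra ::
  "(complex, 'a) module \<Rightarrow> (complex, ('a multiset \<Rightarrow>\<^sub>0 complex) set) module" where
  "sym_algebra V = quot_module (poly_algebra (carrier V)) (sym_ideal V)"

text \<open>
  An endomorphism \<open>f\<close> of \<open>V\<close> extends to the derivation
  \<open>v\<^sub>1 \<cdots> v\<^sub>k \<mapsto> \<Sum>j. v\<^sub>1 \<cdots> f v\<^sub>j \<cdots> v\<^sub>k\<close> of the symmetric algebra.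
\<close>

definition sym_act ::
  "(complex, 'a) module \<Rightarrow> ('a \<Rightarrow> 'a) \<Rightarrow>
     ('a multiset \<Rightarrow>\<^sub>0 complex) set \<Rightarrow> ('a multiset \<Rightarrow>\<^sub>0 complex) set" where
  "sym_act V f =
     quot_map (poly_algebra (carrier V)) (sym_ideal V)
       (\<lambda>p. \<Sum>m\<in>Poly_Mapping.keys p. \<Sum>v\<in>#m.
          Poly_Mapping.single (m - {#v#} + {#f v#}) (Poly_Mapping.lookup p m))"

text \<open>
  The space of linear maps from \<open>M\<close> to \<open>N\<close> commuting with the actions \<open>\<rho>\<close> and \<open>\<sigma>\<close> of \<open>L\<close>.
\<close>

definition hom_module ::
  "'l set \<Rightarrow> (complex, 'a) module \<Rightarrow> ('l \<Rightarrow> 'a \<Rightarrow> 'a) \<Rightarrow>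
     (complex, 'b) module \<Rightarrow> ('l \<Rightarrow> 'b \<Rightarrow> 'b) \<Rightarrow> (complex, 'a \<Rightarrow> 'b) module" where
  "hom_module L M \<rho> N \<sigma> =
     \<lparr>carrier = {F \<in> carrier M \<rightarrow>\<^sub>E carrier N.
        (\<forall>x\<in>carrier M. \<forall>y\<in>carrier M. F (x \<oplus>\<^bsub>M\<^esub> y) = F x \<oplus>\<^bsub>N\<^esub> F y) \<and>
        (\<forall>c. \<forall>x\<in>carrier M. F (c \<odot>\<^bsub>M\<^esub> x) = c \<odot>\<^bsub>N\<^esub> F x) \<and>
        (\<forall>h\<in>L. \<forall>x\<in>carrier M. F (\<rho> h x) = \<sigma> h (F x))},
      monoid.mult = undefined, one = undefined,
      zero = (\<lambda>x\<in>carrier M. \<zero>\<^bsub>N\<^esub>),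
      add = (\<lambda>F G. \<lambda>x\<in>carrier M. F x \<oplus>\<^bsub>N\<^esub> G x),
      smult = (\<lambda>c F. \<lambda>x\<in>carrier M. c \<odot>\<^bsub>N\<^esub> F x)\<rparr>"


section \<open>The pairs of Lie algebras\<close>

text \<open>
  The index \<open>3\<close> of \<open>complex^3\<close> coincides with \<open>0\<close> in the type \<open>3\<close>, so the order of that
  type must not be used to speak about triangular matrices; they are written out instead.
\<close>

definition cscale :: "complex \<Rightarrow> complex^'n^'m \<Rightarrow> complex^'n^'m" where
  "cscale c X = (\<chi> i j. c * X $ i $ j)"

definition Emat :: "'n \<Rightarrow> 'n \<Rightarrow> complex^'n^'n" where
  "Emat i j = (\<chi> k l. if k = i \<and> l = j then 1 else 0)"

definition ad :: "complex^'n^'n \<Rightarrow> complex^'n^'n \<Rightarrow> complex^'n^'n" where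
  "ad X Y = X ** Y - Y ** X"

definition sl2 :: "(complex^2^2) set" where
  "sl2 = {X. trace X = 0}"

definition a_sl :: "(complex^3^3) set" where
  "a_sl = {X. trace X = 0 \<and> (\<forall>i j. i \<noteq> j \<longrightarrow> X $ i $ j = 0)}"

definition n_minus :: "(complex^3^3) set" where
  "n_minus = {vector [vector [0, 0, 0], vector [a, 0, 0], vector [b, c, 0]] | a b c. True}"

definition iota :: "nat \<Rightarrow> complex^2^2 \<Rightarrow> complex^3^3" where
  "iota i X =
     (if i = 1
      then vector [vector [X$1$1, X$1$2, 0], vector [X$2$1, X$2$2, 0], vector [0, 0, 0]]
      else vector [vector [0, 0, 0], vector [0, X$1$1, X$1$2], vector [0, X$2$1, X$2$2]])"

definition g'_sl :: "nat \<Rightarrow> (complex^3^3) set" where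
  "g'_sl i = iota i ` sl2"

definition a'_sl :: "nat \<Rightarrow> (complex^3^3) set" where
  "a'_sl i = {cscale z (iota i (Emat 1 1 - Emat 2 2)) | z. True}"

definition n'_minus :: "nat \<Rightarrow> (complex^3^3) set" where
  "n'_minus i = n_minus \<inter> g'_sl i"

text \<open>
  The characters are given by the matrix entries of their argument that extract the coordinates
  \<open>z\<^sub>1, z\<^sub>2\<close> (or \<open>z\<close>); see \<open>char_sl_coords\<close> and \<open>char_sl'_coords\<close>.
\<close>

definition char_sl :: "complex^2 \<Rightarrow> complex^3^3 \<Rightarrow> complex" where
  "char_sl u H = u$1 * H$1$1 - u$2 * H$3$3"

definition char_sl' :: "nat \<Rightarrow> complex \<Rightarrow> complex^3^3 \<Rightarrow> complex" where
  "char_sl' i v H = v * (if i = 1 then H$1$1 else H$2$2)"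

lemma a_sl_coords:
  "a_sl = {cscale z1 (Emat 1 1 - Emat 2 2) + cscale z2 (Emat 2 2 - Emat 3 3) | z1 z2. True}"
proof (intro equalityI subsetI)
  fix X :: "complex^3^3" assume "X \<in> a_sl"
  then have tr: "X$1$1 + X$2$2 + X$3$3 = 0" and off: "\<And>i j. i \<noteq> j \<Longrightarrow> X$i$j = 0"
    by (auto simp: a_sl_def trace_def sum_3)
  have d: "X$2$2 = - X$1$1 - X$3$3"
    using tr by (simp add: eq_diff_eq eq_neg_iff_add_eq_0 ac_simps)
  have "X = cscale (X$1$1) (Emat 1 1 - Emat 2 2) + cscale (- X$3$3) (Emat 2 2 - Emat 3 3)"
    using d off by (simp add: vec_eq_iff forall_3 cscale_def Emat_def)
  then show "X \<in> {cscale z1 (Emat 1 1 - Emat 2 2) + cscale z2 (Emat 2 2 - Emat 3 3) | z1 z2. True}"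
    by blast
next
  fix X :: "complex^3^3" assume "X \<in> {cscale z1 (Emat 1 1 - Emat 2 2) + cscale z2 (Emat 2 2 - Emat 3 3) | z1 z2. True}"
  then show "X \<in> a_sl"
    by (auto simp: a_sl_def trace_def sum_3 forall_3 cscale_def Emat_def)
qed

lemma char_sl_coords:
  "char_sl u (cscale z1 (Emat 1 1 - Emat 2 2) + cscale z2 (Emat 2 2 - Emat 3 3))
     = u$1 * z1 + u$2 * z2"
  by (simp add: char_sl_def cscale_def Emat_def)

lemma char_sl'_coords:
  assumes "i \<in> {1, 2}"
  shows "char_sl' i v (iota i (cscale z (Emat 1 1 - Emat 2 2))) = v * z"
  using assms by (auto simp: char_sl'_def iota_def cscale_def Emat_def vector_3)

lemma a'_sl_eq:
  "a'_sl i = {iota i (cscale z (Emat 1 1 - Emat 2 2)) | z. True}"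
proof -
  have "cscale z (iota i X) = iota i (cscale z X)" for z X
    by (simp add: vec_eq_iff forall_3 iota_def cscale_def vector_3)
  then show ?thesis by (simp add: a'_sl_def)
qed

lemma n_minus_iff:
  "X \<in> n_minus \<longleftrightarrow> X$1$1 = 0 \<and> X$1$2 = 0 \<and> X$1$3 = 0 \<and> X$2$2 = 0 \<and> X$2$3 = 0 \<and> X$3$3 = 0"
proof
  assume "X$1$1 = 0 \<and> X$1$2 = 0 \<and> X$1$3 = 0 \<and> X$2$2 = 0 \<and> X$2$3 = 0 \<and> X$3$3 = 0"
  then have "X = vector [vector [0, 0, 0], vector [X$2$1, 0, 0], vector [X$3$1, X$3$2, 0]]"
    by (simp add: vec_eq_iff forall_3 vector_3)
  then show "X \<in> n_minus" unfolding n_minus_def by blast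
qed (auto simp: n_minus_def vector_3)


section \<open>The multiplicities\<close>

definition n_quot :: "nat \<Rightarrow> (complex, (complex^3^3) set) module" where
  "n_quot i = quot_module (vspace_on cscale n_minus) (n'_minus i)"

definition n_quot_act :: "nat \<Rightarrow> complex^3^3 \<Rightarrow> (complex^3^3) set \<Rightarrow> (complex^3^3) set" where
  "n_quot_act i H = quot_map (vspace_on cscale n_minus) (n'_minus i) (ad H)"

definition one_dim :: "(complex, complex) module" where
  "one_dim = vspace_on (*) UNIV"

definition char_act :: "('l \<Rightarrow> complex) \<Rightarrow> 'l \<Rightarrow> complex \<Rightarrow> complex" where
  "char_act \<psi> H z = \<psi> H * z"

definition m_sl :: "nat \<Rightarrow> complex \<Rightarrow> complex^2 \<Rightarrow> enat" where
  "m_sl i v u =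
     module_dim (hom_module (a'_sl i)
       one_dim (char_act (char_sl' i v))
       (tensor_module one_dim (sym_algebra (n_quot i)))
       (\<lambda>H. tensor_act one_dim (sym_algebra (n_quot i))
              (char_act (char_sl u) H) (sym_act (n_quot i) (n_quot_act i H))))"

end

theory Submission
  imports Defs
begin

text \<open>
  The quotient \<open>\<nn>\<^sub>- / \<nn>'\<^sub>i\<^sub>,\<^sub>-\<close> is a plane spanned by two root vectors on which a generator of
  \<open>\<aa>'\<^sub>i\<close> has the opposite eigenvalues \<open>-1\<close> and \<open>1\<close>.  Hence its symmetric algebra is
  \<open>\<complex>[X\<^sub>1, X\<^sub>2]\<close> with the monomials as eigenvectors, and \<open>X\<^sub>1 X\<^sub>2\<close> has eigenvalue \<open>0\<close>: once some
  monomial contributes to the multiplicity, so do its products with all powers of \<open>X\<^sub>1 X\<^sub>2\<close>.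
  The multiplicity counts the monomials with one prescribed eigenvalue, and this set of monomials
  is therefore empty or infinite.

  The work lies in making the abstract objects concrete.  Quotients, tensor products and symmetric
  algebras are given by generators and relations, as spaces of cosets.  Each of them is put in
  bijection with a space of polynomials by the same device: a linear map on the space of generators
  is exhibited whose kernel is exactly the span (or ideal) of the relations, so that cosets are its
  fibres (\<open>coordinates_quot\<close>), and an operator that is compatible with the linear map acts on
  cosets as it does on values (\<open>quot_map_coordinates\<close>).  The kernels are identified in
  \<open>tensor_kernel_eq\<close> and \<open>sym_ideal_eq\<close>, by reducing every element modulo the relations to a
  normal form determined by its value.  In these coordinates the equivariant maps out of a
  line are the common eigenvectors in \<open>\<complex>[X\<^sub>1, X\<^sub>2]\<close> (\<open>homs_coords\<close>), and since finitely many
  polynomials involve only finitely many monomials, infinitely many available monomials exclude a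
  finite basis (\<open>module_dim_infinite\<close>).
\<close>

section \<open>Linear extension from a basis\<close>

lemma lookup_pscale [simp]: "Poly_Mapping.lookup (pscale c p) k = c * Poly_Mapping.lookup p k"
  by (simp add: pscale_def Poly_Mapping.map.rep_eq when_def)

lemma pscale_0 [simp]: "pscale 0 p = 0" "pscale c 0 = 0"
  by (simp_all add: poly_mapping_eq_iff fun_eq_iff)

lemma pscale_1 [simp]: "pscale 1 p = p"
  by (simp add: poly_mapping_eq_iff fun_eq_iff)

lemma pscale_add: "pscale c (p + q) = pscale c p + pscale c q"
  by (simp add: poly_mapping_eq_iff fun_eq_iff lookup_add algebra_simps)

lemma pscale_diff: "pscale c (p - q) = pscale c p - pscale c q"
  by (simp add: poly_mapping_eq_iff fun_eq_iff lookup_minus algebra_simps)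

lemma pscale_add_left: "pscale (c + d) p = pscale c p + pscale d p"
  by (simp add: poly_mapping_eq_iff fun_eq_iff lookup_add algebra_simps)

lemma pscale_pscale [simp]: "pscale c (pscale d p) = pscale (c * d) p"
  by (simp add: poly_mapping_eq_iff fun_eq_iff algebra_simps)

lemma pscale_single [simp]: "pscale c (Poly_Mapping.single k a) = Poly_Mapping.single k (c * a)"
  by (simp add: poly_mapping_eq_iff fun_eq_iff lookup_single when_def)

lemma pscale_sum: "pscale c (sum f A) = (\<Sum>x\<in>A. pscale c (f x))"
  by (induction A rule: infinite_finite_induct) (simp_all add: pscale_add)

lemma pscale_sum_mset: "pscale c (\<Sum>x\<in>#A. f x) = (\<Sum>x\<in>#A. pscale c (f x))"
  by (induction A) (simp_all add: pscale_add)

lemma pscale_conv_mult: "pscale c p = Poly_Mapping.single 0 c * p"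
  by (simp add: pscale_def mult_map_scale_conv_mult)

lemma pscale_mult_left: "pscale c p * q = pscale c (p * q)"
  by (simp add: pscale_conv_mult mult.assoc)

lemma pscale_mult_right: "p * pscale c q = pscale c (p * q)"
  for p q :: "'k::comm_monoid_add \<Rightarrow>\<^sub>0 complex"
  by (simp add: pscale_conv_mult mult.left_commute)

lemma keys_pscale: "Poly_Mapping.keys (pscale c p) \<subseteq> Poly_Mapping.keys p"
  by (auto simp: in_keys_iff)

definition lin_ext :: "('k \<Rightarrow> ('j \<Rightarrow>\<^sub>0 complex)) \<Rightarrow> ('k \<Rightarrow>\<^sub>0 complex) \<Rightarrow> ('j \<Rightarrow>\<^sub>0 complex)" where
  "lin_ext f p = (\<Sum>k\<in>Poly_Mapping.keys p. pscale (Poly_Mapping.lookup p k) (f k))"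

definition plinear :: "(('k \<Rightarrow>\<^sub>0 complex) \<Rightarrow> ('j \<Rightarrow>\<^sub>0 complex)) \<Rightarrow> bool" where
  "plinear G \<longleftrightarrow> (\<forall>p q. G (p + q) = G p + G q) \<and> (\<forall>c p. G (pscale c p) = pscale c (G p))"

lemma plinear_add: "plinear G \<Longrightarrow> G (p + q) = G p + G q"
  and plinear_pscale: "plinear G \<Longrightarrow> G (pscale c p) = pscale c (G p)"
  by (simp_all add: plinear_def)

lemma plinear_0: "plinear G \<Longrightarrow> G 0 = 0"
  using plinear_pscale[of G 0 0] by simp

lemma plinear_diff: "plinear G \<Longrightarrow> G (p - q) = G p - G q"
  using plinear_add[of G "p - q" q] by simp

lemma plinear_sum: "plinear G \<Longrightarrow> G (sum f A) = (\<Sum>x\<in>A. G (f x))"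
  by (induction A rule: infinite_finite_induct) (simp_all add: plinear_add plinear_0)

lemma plinear_sum_mset: "plinear G \<Longrightarrow> G (\<Sum>x\<in>#A. f x) = (\<Sum>x\<in>#A. G (f x))"
  by (induction A) (simp_all add: plinear_add plinear_0)

lemma lin_ext_superset:
  assumes "finite K" "Poly_Mapping.keys p \<subseteq> K"
  shows "lin_ext f p = (\<Sum>k\<in>K. pscale (Poly_Mapping.lookup p k) (f k))"
  unfolding lin_ext_def
  by (rule sum.mono_neutral_left) (use assms in \<open>auto simp: in_keys_iff\<close>)

lemma plinear_lin_ext [simp]: "plinear (lin_ext f)"
  unfolding plinear_def
proof safe
  fix p q :: "'a \<Rightarrow>\<^sub>0 complex" and c
  let ?K = "Poly_Mapping.keys p \<union> Poly_Mapping.keys q"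
  show "lin_ext f (p + q) = lin_ext f p + lin_ext f q"
    using keys_add[of p q]
    by (simp add: lin_ext_superset[of ?K] lookup_add pscale_add_left sum.distrib)
  show "lin_ext f (pscale c p) = pscale c (lin_ext f p)"
    using keys_pscale[of c p]
    by (simp add: lin_ext_superset[of "Poly_Mapping.keys p"] pscale_sum)
qed

lemma lin_ext_single [simp]: "lin_ext f (Poly_Mapping.single k c) = pscale c (f k)"
  by (simp add: lin_ext_def)

lemma plinear_lin_ext_comp: "plinear G \<Longrightarrow> G (lin_ext f p) = lin_ext (\<lambda>k. G (f k)) p"
  by (simp add: lin_ext_def plinear_sum plinear_pscale)

lemma lin_ext_cong: "(\<And>k. k \<in> Poly_Mapping.keys p \<Longrightarrow> f k = g k) \<Longrightarrow> lin_ext f p = lin_ext g p"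
  by (simp add: lin_ext_def)

lemma lin_ext_plus: "lin_ext (\<lambda>k. f k + g k) p = lin_ext f p + lin_ext g p"
  by (simp add: lin_ext_def pscale_add sum.distrib)

lemma lin_ext_pscale: "lin_ext (\<lambda>k. pscale c (f k)) p = pscale c (lin_ext f p)"
  by (simp add: lin_ext_def pscale_sum mult.commute)

lemma lin_ext_basis: "lin_ext (\<lambda>k. Poly_Mapping.single k 1) p = p"
  by (auto simp: lin_ext_def poly_mapping_eq_iff fun_eq_iff lookup_sum lookup_single when_def in_keys_iff)

lemma keys_lin_ext:
  "Poly_Mapping.keys (lin_ext f p) \<subseteq> (\<Union>k\<in>Poly_Mapping.keys p. Poly_Mapping.keys (f k))"
  unfolding lin_ext_def using keys_sum keys_pscale by fastforce

text \<open>
  The key set is controlled only at the singletons and not along sums, so that the rule applies to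
  properties that make no mention of \<open>K\<close>.
\<close>

lemma poly_mapping_keys_induct [consumes 1, case_names zero single add]:
  assumes "Poly_Mapping.keys p \<subseteq> K"
    and "P 0"
    and "\<And>k c. k \<in> K \<Longrightarrow> P (Poly_Mapping.single k c)"
    and "\<And>p q. P p \<Longrightarrow> P q \<Longrightarrow> P (p + q)"
  shows "P (p :: 'k \<Rightarrow>\<^sub>0 complex)"
proof -
  have "P (\<Sum>k\<in>A. Poly_Mapping.single k (Poly_Mapping.lookup p k))" if "A \<subseteq> K" "finite A" for A
    using that(2,1) by induction (auto intro: assms)
  moreover have "(\<Sum>k\<in>Poly_Mapping.keys p. Poly_Mapping.single k (Poly_Mapping.lookup p k)) = p"
    using lin_ext_basis[of p] by (simp add: lin_ext_def)
  ultimately show ?thesis using assms(1) by (metis finite_keys)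
qed

text \<open>
  For a monoid homomorphism \<open>f\<close> the linear extension is the induced homomorphism of monoid
  algebras; both sides are bilinear, so it is enough to compare them on basis elements.
\<close>

lemma lin_ext_mult:
  fixes f :: "'k::comm_monoid_add \<Rightarrow> 'j::comm_monoid_add \<Rightarrow>\<^sub>0 complex"
  assumes "\<And>k l. f (k + l) = f k * f l"
  shows "lin_ext f (p * q) = lin_ext f p * lin_ext f q"
proof -
  have single: "lin_ext f (Poly_Mapping.single k c * q) = pscale c (f k) * lin_ext f q" for k c
    using subset_UNIV[of "Poly_Mapping.keys q"]
    by (induction q rule: poly_mapping_keys_induct)
      (simp_all add: mult_single assms plinear_0 plinear_add[OF plinear_lin_ext] distrib_left
         pscale_mult_left pscale_mult_right mult.commute[where 'a = complex])
  show ?thesis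
    using subset_UNIV[of "Poly_Mapping.keys p"]
    by (induction p rule: poly_mapping_keys_induct)
      (simp_all add: single plinear_0 plinear_add[OF plinear_lin_ext] distrib_right)
qed

text \<open>The derivation of the polynomial algebra for which every indeterminate is an eigenvector.\<close>

definition weight_derivation ::
  "('n \<Rightarrow> complex) \<Rightarrow> ('n multiset \<Rightarrow>\<^sub>0 complex) \<Rightarrow> ('n multiset \<Rightarrow>\<^sub>0 complex)" where
  "weight_derivation w = lin_ext (\<lambda>m. Poly_Mapping.single m (\<Sum>j\<in>#m. w j))"

lemma plinear_weight_derivation: "plinear (weight_derivation w)"
  by (simp add: weight_derivation_def)

lemma lookup_weight_derivation:
  "Poly_Mapping.lookup (weight_derivation w p) m = (\<Sum>j\<in>#m. w j) * Poly_Mapping.lookup p m"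
  by (auto simp: weight_derivation_def lin_ext_def lookup_sum lookup_single when_def in_keys_iff
      mult.commute)

text \<open>
  The eigenvalue of a monomial is additive in its exponents, which is the Leibniz rule on basis
  elements.
\<close>

lemma weight_derivation_mult:
  "weight_derivation w (p * q) = weight_derivation w p * q + p * weight_derivation w q"
proof -
  note lin = plinear_0[OF plinear_weight_derivation] plinear_add[OF plinear_weight_derivation]
  have single: "weight_derivation w (Poly_Mapping.single k c * q) =
      weight_derivation w (Poly_Mapping.single k c) * q + Poly_Mapping.single k c * weight_derivation w q" for k c
    using subset_UNIV[of "Poly_Mapping.keys q"]
  proof (induction q rule: poly_mapping_keys_induct)
    case (single l d)
    show ?case
      by (simp add: weight_derivation_def mult_single single_add[symmetric] algebra_simps)
  qed (simp_all add: lin algebra_simps)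
  show ?thesis
    using subset_UNIV[of "Poly_Mapping.keys p"]
    by (induction p rule: poly_mapping_keys_induct) (simp_all add: single lin distrib_left distrib_right add_ac)
qed


section \<open>Coordinates on modules and on quotients by kernels\<close>

text \<open>
  A module that is identified by \<open>\<theta>\<close> with a part of a vector space given by a type.  It is enough
  to relate the operations: injectivity carries the laws of addition over from the type.
\<close>

locale coordinates =
  fixes sc :: "complex \<Rightarrow> 'w \<Rightarrow> 'w::ab_group_add"
    and M :: "(complex, 'a) module" (structure)
    and \<theta> :: "'a \<Rightarrow> 'w"
  assumes inj: "inj_on \<theta> (carrier M)"
    and zero_closed: "\<zero> \<in> carrier M"
    and coord_zero: "\<theta> \<zero> = 0"
    and add_closed: "x \<in> carrier M \<Longrightarrow> y \<in> carrier M \<Longrightarrow> x \<oplus> y \<in> carrier M"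
    and coord_add: "x \<in> carrier M \<Longrightarrow> y \<in> carrier M \<Longrightarrow> \<theta> (x \<oplus> y) = \<theta> x + \<theta> y"
    and smult_closed: "x \<in> carrier M \<Longrightarrow> c \<odot> x \<in> carrier M"
    and coord_smult: "x \<in> carrier M \<Longrightarrow> \<theta> (c \<odot> x) = sc c (\<theta> x)"
begin

lemma coord_eqI: "x \<in> carrier M \<Longrightarrow> y \<in> carrier M \<Longrightarrow> \<theta> x = \<theta> y \<Longrightarrow> x = y"
  using inj by (rule inj_onD)

lemma abelian_monoid: "abelian_monoid M"
  by (rule abelian_monoidI)
    (auto intro!: coord_eqI intro: add_closed zero_closed simp: coord_add coord_zero add_closed zero_closed add_ac)

lemma coord_finsum:
  assumes "finite B" "f \<in> B \<rightarrow> carrier M"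
  shows "\<theta> (finsum M f B) = (\<Sum>b\<in>B. \<theta> (f b))"
proof -
  interpret abelian_monoid M by (rule abelian_monoid)
  show ?thesis using assms
    by induction (auto simp: coord_zero coord_add Pi_iff)
qed

end

locale full_coordinates = coordinates +
  assumes surj: "\<theta> ` carrier M = UNIV"
begin

definition elem where "elem w = inv_into (carrier M) \<theta> w"

lemma elem_mem [simp]: "elem w \<in> carrier M" and coord_elem [simp]: "\<theta> (elem w) = w"
  unfolding elem_def using surj by (auto intro: inv_into_into f_inv_into_f)

lemma elem_coord: "x \<in> carrier M \<Longrightarrow> elem (\<theta> x) = x"
  by (rule coord_eqI) simp_all

lemma elem_add: "elem (w + w') = elem w \<oplus> elem w'"
  by (rule coord_eqI) (simp_all add: add_closed coord_add)

lemma elem_zero: "elem 0 = \<zero>"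
  by (rule coord_eqI) (simp_all add: zero_closed coord_zero)

lemma elem_scale: "elem (sc c w) = c \<odot> elem w"
  by (rule coord_eqI) (simp_all add: smult_closed coord_smult)

end

definition fibre_value :: "('a \<Rightarrow> 'w) \<Rightarrow> 'a set \<Rightarrow> 'w" where
  "fibre_value \<Phi> X = the_elem (\<Phi> ` X)"

definition map_ker :: "(complex, 'a) module \<Rightarrow> ('a \<Rightarrow> 'w::zero) \<Rightarrow> 'a set" where
  "map_ker M \<Phi> = {x \<in> carrier M. \<Phi> x = 0}"

text \<open>
  A linear map on a module whose addition is that of its type; all modules of which quotients are
  taken here have this form.
\<close>

locale linear_map_on =
  fixes sc :: "complex \<Rightarrow> 'w \<Rightarrow> 'w::ab_group_add"
    and M :: "(complex, 'a::ab_group_add) module" (structure)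
    and \<Phi> :: "'a \<Rightarrow> 'w"
  assumes add_eq: "add M = (+)" and zero_eq: "zero M = 0"
    and zero_mem: "0 \<in> carrier M"
    and diff_mem: "x \<in> carrier M \<Longrightarrow> y \<in> carrier M \<Longrightarrow> x - y \<in> carrier M"
    and smult_mem: "x \<in> carrier M \<Longrightarrow> c \<odot> x \<in> carrier M"
    and map_diff: "x \<in> carrier M \<Longrightarrow> y \<in> carrier M \<Longrightarrow> \<Phi> (x - y) = \<Phi> x - \<Phi> y"
    and map_smult: "x \<in> carrier M \<Longrightarrow> \<Phi> (c \<odot> x) = sc c (\<Phi> x)"
begin

lemma uminus_mem: "x \<in> carrier M \<Longrightarrow> - x \<in> carrier M"
  using diff_mem[OF zero_mem] by simp

lemma add_mem: "x \<in> carrier M \<Longrightarrow> y \<in> carrier M \<Longrightarrow> x + y \<in> carrier M"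
  using diff_mem[OF _ uminus_mem] by fastforce

lemma map_zero: "\<Phi> 0 = 0"
  using map_diff[OF zero_mem zero_mem] by simp

lemma map_add: "x \<in> carrier M \<Longrightarrow> y \<in> carrier M \<Longrightarrow> \<Phi> (x + y) = \<Phi> x + \<Phi> y"
  using map_diff[of "x + y" y] add_mem by (simp add: algebra_simps)

abbreviation ker where "ker \<equiv> map_ker M \<Phi>"

lemma coset_eq_fibre:
  assumes "x \<in> carrier M"
  shows "ker +> x = {y \<in> carrier M. \<Phi> y = \<Phi> x}"
proof -
  have "y \<in> (\<Union>h\<in>ker. {h + x})" if "y \<in> carrier M" "\<Phi> y = \<Phi> x" for y
    by (rule UN_I[of "y - x"]) (use that assms in \<open>auto simp: map_ker_def diff_mem map_diff\<close>)
  then show ?thesis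
    using assms by (auto simp: a_r_coset_def' add_eq map_ker_def add_mem map_add)
qed

lemma fibre_value_coset: "x \<in> carrier M \<Longrightarrow> fibre_value \<Phi> (ker +> x) = \<Phi> x"
proof -
  assume "x \<in> carrier M"
  then have "\<Phi> ` (ker +> x) = {\<Phi> x}" by (auto simp: coset_eq_fibre)
  then show ?thesis by (simp add: fibre_value_def)
qed

lemma carrier_quot: "carrier (quot_module M ker) = (\<lambda>x. ker +> x) ` carrier M"
  by (auto simp: quot_module_def A_RCOSETS_def')

text \<open>
  Compatibility with \<open>\<Phi>\<close> makes \<open>f\<close> send a fibre into a fibre, so the union that defines
  \<open>quot_map\<close> consists of copies of a single coset.
\<close>

lemma quot_map_coset:
  assumes "\<And>y. y \<in> carrier M \<Longrightarrow> f y \<in> carrier M \<and> \<Phi> (f y) = g (\<Phi> y)" "x \<in> carrier M"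
  shows "quot_map M ker f (ker +> x) = ker +> f x"
proof -
  have "ker +> f y = ker +> f x" if "y \<in> ker +> x" for y
    using that assms by (simp add: coset_eq_fibre)
  moreover have "x \<in> ker +> x" using assms by (simp add: coset_eq_fibre)
  ultimately show ?thesis unfolding quot_map_def by blast
qed

lemma quot_map_coordinates:
  assumes "\<And>y. y \<in> carrier M \<Longrightarrow> f y \<in> carrier M \<and> \<Phi> (f y) = g (\<Phi> y)"
    and "X \<in> carrier (quot_module M ker)"
  shows "quot_map M ker f X \<in> carrier (quot_module M ker)"
    and "fibre_value \<Phi> (quot_map M ker f X) = g (fibre_value \<Phi> X)"
proof -
  obtain x where x: "x \<in> carrier M" "X = ker +> x" using assms(2) by (auto simp: carrier_quot)
  have eq: "quot_map M ker f X = ker +> f x"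
    unfolding x(2) using assms(1) x(1) by (rule quot_map_coset)
  have fx: "f x \<in> carrier M" "\<Phi> (f x) = g (\<Phi> x)" using assms(1) x(1) by auto
  show "quot_map M ker f X \<in> carrier (quot_module M ker)"
    unfolding eq using fx by (simp add: carrier_quot)
  show "fibre_value \<Phi> (quot_map M ker f X) = g (fibre_value \<Phi> X)"
    unfolding eq using fx x by (simp add: fibre_value_coset)
qed

lemma coset_add:
  assumes "x \<in> carrier M" "y \<in> carrier M"
  shows "(ker +> x) <+> (ker +> y) = ker +> (x + y)"
proof -
  have "z \<in> (\<Union>h\<in>ker +> x. \<Union>k\<in>ker +> y. {h + k})" if z: "z \<in> carrier M" "\<Phi> z = \<Phi> x + \<Phi> y" for z
    by (rule UN_I[of x], simp add: coset_eq_fibre assms, rule UN_I[of "z - x"])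
      (use assms z in \<open>auto simp: coset_eq_fibre diff_mem map_diff\<close>)
  then show ?thesis
    using assms by (auto simp: set_add_def' add_eq coset_eq_fibre add_mem map_add)
qed

text \<open>
  The isomorphism theorem: cosets of the kernel are fibres of \<open>\<Phi>\<close>, so the value of \<open>\<Phi>\<close> is a
  coordinate on the quotient.
\<close>

lemma coordinates_quot: "coordinates sc (quot_module M ker) (fibre_value \<Phi>)"
proof
  have smult: "smult (quot_module M ker) c X = quot_map M ker (smult M c) X" for c X
    by (simp add: quot_module_def)
  have add: "add (quot_module M ker) = set_add M"
    by (simp add: quot_module_def)
  show "inj_on (fibre_value \<Phi>) (carrier (quot_module M ker))"
  proof (rule inj_onI)
    fix X Y assume "X \<in> carrier (quot_module M ker)" "Y \<in> carrier (quot_module M ker)"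
      and eq: "fibre_value \<Phi> X = fibre_value \<Phi> Y"
    then obtain x y where xy: "x \<in> carrier M" "X = ker +> x" "y \<in> carrier M" "Y = ker +> y"
      by (auto simp: carrier_quot)
    with eq have "\<Phi> x = \<Phi> y" by (simp add: fibre_value_coset)
    then show "X = Y" using xy by (simp add: coset_eq_fibre)
  qed
  have zero: "\<zero>\<^bsub>quot_module M ker\<^esub> = ker +> 0"
    using coset_eq_fibre[OF zero_mem] by (simp add: map_zero quot_module_def map_ker_def)
  show "\<zero>\<^bsub>quot_module M ker\<^esub> \<in> carrier (quot_module M ker)"
    by (simp add: zero carrier_quot zero_mem)
  show "fibre_value \<Phi> \<zero>\<^bsub>quot_module M ker\<^esub> = 0"
    by (simp add: zero fibre_value_coset zero_mem map_zero)
  fix X Y c assume X: "X \<in> carrier (quot_module M ker)"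
  show "smult (quot_module M ker) c X \<in> carrier (quot_module M ker)"
    "fibre_value \<Phi> (smult (quot_module M ker) c X) = sc c (fibre_value \<Phi> X)"
    unfolding smult
    by (rule quot_map_coordinates[where g = "sc c"], simp_all add: smult_mem map_smult X)+
  assume Y: "Y \<in> carrier (quot_module M ker)"
  show "X \<oplus>\<^bsub>quot_module M ker\<^esub> Y \<in> carrier (quot_module M ker)"
    "fibre_value \<Phi> (X \<oplus>\<^bsub>quot_module M ker\<^esub> Y) = fibre_value \<Phi> X + fibre_value \<Phi> Y"
    using X Y unfolding add
    by (auto simp: carrier_quot coset_add add_mem fibre_value_coset map_add)
qed

lemma fibre_value_image: "fibre_value \<Phi> ` carrier (quot_module M ker) = \<Phi> ` carrier M"
  by (auto simp: carrier_quot image_image fibre_value_coset)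

lemma abelian_group: "abelian_group M"
  by (rule abelian_groupI)
    (auto simp: add_eq zero_eq add_mem zero_mem add_ac intro: bexI[of _ "- x" for x] uminus_mem)

lemma subgroup_ker: "subgroup ker (add_monoid M)"
proof -
  interpret abelian_group M by (rule abelian_group)
  have "\<ominus> x = - x" if "x \<in> carrier M" for x
    using that by (intro minus_equality) (simp_all add: add_eq zero_eq uminus_mem)
  then show ?thesis
    by (intro add.subgroupI)
      (auto intro: exI[of _ 0] simp: map_ker_def add_eq add_mem map_add map_zero zero_mem uminus_mem
        map_diff[OF zero_mem, simplified] simp flip: a_inv_def)
qed

lemma submodule_ker:
  assumes "\<And>c. sc c 0 = 0"
  shows "submodule ker complex_ring M"
  by (intro submodule.intro submodule_axioms.intro subgroup_ker)
    (auto simp: map_ker_def smult_mem map_smult assms)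

end

lemma linear_map_on_free: "plinear G \<Longrightarrow> linear_map_on pscale (free_module K) G"
  by unfold_locales
    (simp_all add: free_module_def vspace_on_def plinear_diff plinear_pscale
      subset_trans[OF keys_pscale] subset_trans[OF keys_diff])

lemma linear_map_on_poly_algebra: "plinear G \<Longrightarrow> linear_map_on pscale (poly_algebra V) G"
  by unfold_locales
    (auto simp: poly_algebra_def plinear_diff plinear_pscale
      dest!: subsetD[OF keys_pscale] subsetD[OF keys_diff])


section \<open>Tensor products with a line\<close>

lemma submodule_freeD:
  assumes "submodule S complex_ring (free_module K)"
  shows "0 \<in> S" "p \<in> S \<Longrightarrow> q \<in> S \<Longrightarrow> p + q \<in> S" "p \<in> S \<Longrightarrow> pscale c p \<in> S"
    "p \<in> S \<Longrightarrow> q \<in> S \<Longrightarrow> p - q \<in> S"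
proof -
  interpret submodule S complex_ring "free_module K" by (rule assms)
  show zero: "0 \<in> S" and add: "p \<in> S \<Longrightarrow> q \<in> S \<Longrightarrow> p + q \<in> S" for p q
    using one_closed m_closed by (auto simp: free_module_def vspace_on_def)
  show scale: "p \<in> S \<Longrightarrow> pscale c p \<in> S" for p c
    using smult_closed by (auto simp: free_module_def vspace_on_def complex_ring_def)
  have "pscale (- 1) q = - q" for q :: "'a \<Rightarrow>\<^sub>0 complex"
    by (simp add: poly_mapping_eq_iff fun_eq_iff)
  then show "p \<in> S \<Longrightarrow> q \<in> S \<Longrightarrow> p - q \<in> S"
    using add[of p "- q"] scale[of q "- 1"] by simp
qed

text \<open>
  The map \<open>\<complex> \<otimes> N \<rightarrow> N\<close>, \<open>z \<otimes> y \<mapsto> z y\<close>, before passing to the quotient and in the coordinates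
  \<open>\<theta>\<close> of \<open>N\<close>.
\<close>

definition tensor_eval :: "('b \<Rightarrow> ('k \<Rightarrow>\<^sub>0 complex)) \<Rightarrow> (complex \<times> 'b \<Rightarrow>\<^sub>0 complex) \<Rightarrow> ('k \<Rightarrow>\<^sub>0 complex)" where
  "tensor_eval \<theta> = lin_ext (\<lambda>(z, y). pscale z (\<theta> y))"

lemma carrier_one_dim [simp]: "carrier one_dim = UNIV"
  and add_one_dim [simp]: "x \<oplus>\<^bsub>one_dim\<^esub> y = x + y"
  and smult_one_dim [simp]: "c \<odot>\<^bsub>one_dim\<^esub> x = c * x"
  by (simp_all add: one_dim_def vspace_on_def)

lemma plinear_tensor_eval [simp]: "plinear (tensor_eval \<theta>)"
  by (simp add: tensor_eval_def)

lemma tensor_eval_single [simp]: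
  "tensor_eval \<theta> (Poly_Mapping.single (z, y) c) = pscale (c * z) (\<theta> y)"
  by (simp add: tensor_eval_def)

locale line_tensor = full_coordinates pscale N \<theta> for N and \<theta> :: "'b \<Rightarrow> ('k \<Rightarrow>\<^sub>0 complex)"
begin

lemma carrier_free [simp]: "carrier (free_module K) = {p. Poly_Mapping.keys p \<subseteq> K}"
  by (simp add: free_module_def vspace_on_def)

sublocale T: linear_map_on pscale "free_module (UNIV \<times> carrier N)" "tensor_eval \<theta>"
  by (rule linear_map_on_free) simp

lemma tensor_relations_ker: "tensor_relations one_dim N \<subseteq> T.ker"
proof
  note lin = plinear_diff[OF plinear_tensor_eval]
  have single: "Poly_Mapping.single (x, y) c \<in> carrier (free_module (UNIV \<times> carrier N))"
    if "y \<in> carrier N" for x y c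
    using that by simp
  fix p assume "p \<in> tensor_relations one_dim N"
  then consider x x' y where "y \<in> carrier N"
      "p = Poly_Mapping.single (x + x', y) 1 - Poly_Mapping.single (x, y) 1 - Poly_Mapping.single (x', y) 1"
    | x y y' where "y \<in> carrier N" "y' \<in> carrier N"
      "p = Poly_Mapping.single (x, y \<oplus>\<^bsub>N\<^esub> y') 1 - Poly_Mapping.single (x, y) 1 - Poly_Mapping.single (x, y') 1"
    | c x y where "y \<in> carrier N"
      "p = Poly_Mapping.single (c * x, y) 1 - Poly_Mapping.single (x, y) c"
    | c x y where "y \<in> carrier N"
      "p = Poly_Mapping.single (x, c \<odot>\<^bsub>N\<^esub> y) 1 - Poly_Mapping.single (x, y) c"
    unfolding tensor_relations_def Un_iff mem_Collect_eq add_one_dim smult_one_dim by blast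
  then show "p \<in> T.ker"
  proof cases
    case 1
    have "p \<in> carrier (free_module (UNIV \<times> carrier N))"
      unfolding 1(2) by (intro T.diff_mem single 1)
    moreover have "tensor_eval \<theta> p = 0"
      by (simp add: 1 lin pscale_add_left)
    ultimately show ?thesis by (simp add: map_ker_def)
  next
    case 2
    have "p \<in> carrier (free_module (UNIV \<times> carrier N))"
      unfolding 2(3) by (intro T.diff_mem single add_closed 2)
    moreover have "tensor_eval \<theta> p = 0"
      by (simp add: 2 lin coord_add pscale_add)
    ultimately show ?thesis by (simp add: map_ker_def)
  next
    case 3
    have "p \<in> carrier (free_module (UNIV \<times> carrier N))"
      unfolding 3(2) by (intro T.diff_mem single 3)
    moreover have "tensor_eval \<theta> p = 0"
      by (simp add: 3 lin)
    ultimately show ?thesis by (simp add: map_ker_def)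
  next
    case 4
    have "p \<in> carrier (free_module (UNIV \<times> carrier N))"
      unfolding 4(2) by (intro T.diff_mem single smult_closed 4)
    moreover have "tensor_eval \<theta> p = 0"
      by (simp add: 4 lin coord_smult mult.commute)
    ultimately show ?thesis by (simp add: map_ker_def)
  qed
qed

text \<open>
  Every tensor is congruent to one of the form \<open>1 \<otimes> y\<close>: move scalars to the right factor and
  then add.  The vector \<open>y\<close> is forced to be the one with coordinates \<open>tensor_eval \<theta> p\<close>.
\<close>

lemma reduce_mod_tensor_relations:
  assumes S: "submodule S complex_ring (free_module (UNIV \<times> carrier N))"
    and rel: "tensor_relations one_dim N \<subseteq> S"
    and "Poly_Mapping.keys p \<subseteq> UNIV \<times> carrier N"
  shows "p - Poly_Mapping.single (1, elem (tensor_eval \<theta> p)) 1 \<in> S"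
proof -
  note S = submodule_freeD[OF S]
  have sum_rel: "Poly_Mapping.single (1, y \<oplus>\<^bsub>N\<^esub> y') 1 - Poly_Mapping.single (1, y) 1 - Poly_Mapping.single (1, y') 1 \<in> S"
    if "y \<in> carrier N" "y' \<in> carrier N" for y y'
    by (rule subsetD[OF rel], unfold tensor_relations_def, rule UnI1, rule UnI1, rule UnI2, rule CollectI)
      (use that in auto)
  have left: "Poly_Mapping.single (z, y) 1 - Poly_Mapping.single (1, y) z \<in> S" if "y \<in> carrier N" for z y
    by (rule subsetD[OF rel], unfold tensor_relations_def, rule UnI1, rule UnI2, rule CollectI,
        rule exI[of _ z], rule exI[of _ 1], rule exI[of _ y])
      (use that in auto)
  have right: "Poly_Mapping.single (1, c \<odot>\<^bsub>N\<^esub> y) 1 - Poly_Mapping.single (1, y) c \<in> S"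
    if "y \<in> carrier N" for c y
    by (rule subsetD[OF rel], unfold tensor_relations_def, rule UnI2, rule CollectI) (use that in auto)
  show ?thesis
    using assms(3)
  proof (induction p rule: poly_mapping_keys_induct)
    case zero
    have "0 \<odot>\<^bsub>N\<^esub> \<zero>\<^bsub>N\<^esub> = \<zero>\<^bsub>N\<^esub>"
      by (rule coord_eqI) (simp_all add: smult_closed coord_smult zero_closed coord_zero)
    then have "Poly_Mapping.single (1, \<zero>\<^bsub>N\<^esub>) 1 \<in> S"
      using right[of "\<zero>\<^bsub>N\<^esub>" 0] by (simp add: zero_closed)
    then show ?case using S(4)[OF S(1)] by (simp add: plinear_0 elem_zero)
  next
    case (single k c)
    obtain z y where k: "k = (z, y)" "y \<in> carrier N" using single by auto
    have "Poly_Mapping.single (z, y) c - Poly_Mapping.single (1, (c * z) \<odot>\<^bsub>N\<^esub> y) 1 =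
        pscale c (Poly_Mapping.single (z, y) 1 - Poly_Mapping.single (1, y) z) -
        (Poly_Mapping.single (1, (c * z) \<odot>\<^bsub>N\<^esub> y) 1 - Poly_Mapping.single (1, y) (c * z))"
      by (simp add: pscale_diff)
    also have "\<dots> \<in> S" using k left right S by blast
    finally show ?case using k by (simp add: elem_scale elem_coord)
  next
    case (add p q)
    let ?p = "elem (tensor_eval \<theta> p)" and ?q = "elem (tensor_eval \<theta> q)"
    have "p + q - Poly_Mapping.single (1, ?p \<oplus>\<^bsub>N\<^esub> ?q) 1 =
        (p - Poly_Mapping.single (1, ?p) 1) + (q - Poly_Mapping.single (1, ?q) 1) -
        (Poly_Mapping.single (1, ?p \<oplus>\<^bsub>N\<^esub> ?q) 1 - Poly_Mapping.single (1, ?p) 1 - Poly_Mapping.single (1, ?q) 1)"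
      by simp
    also have "\<dots> \<in> S" using S add.IH sum_rel[of ?p ?q] by (metis elem_mem)
    finally show ?case by (simp add: plinear_add[OF plinear_tensor_eval] elem_add)
  qed
qed

lemma tensor_kernel_eq: "tensor_kernel one_dim N = T.ker"
proof
  show "tensor_kernel one_dim N \<subseteq> T.ker"
    unfolding tensor_kernel_def submodule_gen_def
    using T.submodule_ker tensor_relations_ker by auto
  show "T.ker \<subseteq> tensor_kernel one_dim N"
  proof
    fix p assume p: "p \<in> T.ker"
    have "p \<in> S" if S: "submodule S complex_ring (free_module (UNIV \<times> carrier N))"
      and rel: "tensor_relations one_dim N \<subseteq> S" for S
    proof -
      note reduce = reduce_mod_tensor_relations[OF S rel]
      have "p - Poly_Mapping.single (1, elem 0) 1 \<in> S"
        using reduce[of p] p by (simp add: map_ker_def)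
      moreover have "- Poly_Mapping.single (1, elem 0) 1 \<in> S"
        using reduce[of 0] by (simp add: plinear_0)
      ultimately show ?thesis using submodule_freeD(4)[OF S] by fastforce
    qed
    then show "p \<in> tensor_kernel one_dim N"
      by (simp add: tensor_kernel_def submodule_gen_def)
  qed
qed

lemma tensor_module_eq:
  "tensor_module one_dim N = quot_module (free_module (UNIV \<times> carrier N)) T.ker"
  by (simp add: tensor_module_def tensor_kernel_eq)

lemma full_coordinates_tensor:
  "full_coordinates pscale (tensor_module one_dim N) (fibre_value (tensor_eval \<theta>))"
proof -
  have onto: "w \<in> tensor_eval \<theta> ` carrier (free_module (UNIV \<times> carrier N))" for w
    by (rule image_eqI[of _ _ "Poly_Mapping.single (1, elem w) 1"]) simp_all
  show ?thesis
    unfolding tensor_module_eq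
    by (intro full_coordinates.intro full_coordinates_axioms.intro T.coordinates_quot)
      (simp only: T.fibre_value_image UNIV_eq_I[OF onto, symmetric])
qed

text \<open>
  The factor \<open>\<complex>\<close> disappears from the tensor product, and its character \<open>a\<close> survives as a shift of
  the operator \<open>G\<close>.
\<close>

lemma tensor_act_coordinates:
  assumes g: "\<And>y. y \<in> carrier N \<Longrightarrow> g y \<in> carrier N \<and> \<theta> (g y) = G (\<theta> y)"
    and G: "plinear G"
    and X: "X \<in> carrier (tensor_module one_dim N)"
  shows "tensor_act one_dim N (\<lambda>z. a * z) g X \<in> carrier (tensor_module one_dim N)"
    and "fibre_value (tensor_eval \<theta>) (tensor_act one_dim N (\<lambda>z. a * z) g X) =
      pscale a (fibre_value (tensor_eval \<theta>) X) + G (fibre_value (tensor_eval \<theta>) X)"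
proof -
  define D where "D p = (\<Sum>(x, y)\<in>Poly_Mapping.keys p.
      Poly_Mapping.single (a * x, y) (Poly_Mapping.lookup p (x, y)) +
      Poly_Mapping.single (x, g y) (Poly_Mapping.lookup p (x, y)))" for p :: "complex \<times> 'b \<Rightarrow>\<^sub>0 complex"
  define d where "d = (\<lambda>(x, y). Poly_Mapping.single (a * x, y) (1::complex) + Poly_Mapping.single (x, g y) 1)"
  have D: "D = lin_ext d"
  proof
    show "D p = lin_ext d p" for p
      unfolding D_def lin_ext_def
    proof (rule sum.cong[OF refl])
      fix k assume "k \<in> Poly_Mapping.keys p"
      show "(case k of (x, y) \<Rightarrow> Poly_Mapping.single (a * x, y) (Poly_Mapping.lookup p (x, y)) +
          Poly_Mapping.single (x, g y) (Poly_Mapping.lookup p (x, y))) = pscale (Poly_Mapping.lookup p k) (d k)"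
        by (cases k) (simp add: d_def pscale_add)
    qed
  qed
  have "D p \<in> carrier (free_module (UNIV \<times> carrier N)) \<and>
      tensor_eval \<theta> (D p) = pscale a (tensor_eval \<theta> p) + G (tensor_eval \<theta> p)"
    if p: "p \<in> carrier (free_module (UNIV \<times> carrier N))" for p
  proof
    have "Poly_Mapping.keys (d k) \<subseteq> UNIV \<times> carrier N" if k: "k \<in> Poly_Mapping.keys p" for k
    proof -
      have "k \<in> UNIV \<times> carrier N"
        using p k unfolding carrier_free mem_Collect_eq by (rule subsetD)
      then obtain x y where "k = (x, y)" "y \<in> carrier N" by (rule SigmaE)
      then show ?thesis using g by (simp add: d_def subset_trans[OF keys_add])
    qed
    then show "D p \<in> carrier (free_module (UNIV \<times> carrier N))"
      unfolding D carrier_free mem_Collect_eq by (intro subset_trans[OF keys_lin_ext] UN_least)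
    have "tensor_eval \<theta> (D p) = lin_ext (\<lambda>k. tensor_eval \<theta> (d k)) p"
      unfolding D by (rule plinear_lin_ext_comp) simp
    also have "\<dots> = lin_ext (\<lambda>k. pscale a ((\<lambda>(z, y). pscale z (\<theta> y)) k) + G ((\<lambda>(z, y). pscale z (\<theta> y)) k)) p"
    proof (rule lin_ext_cong)
      fix k assume k: "k \<in> Poly_Mapping.keys p"
      have "k \<in> UNIV \<times> carrier N"
        using p k unfolding carrier_free mem_Collect_eq by (rule subsetD)
      then obtain x y where "k = (x, y)" "y \<in> carrier N" by (rule SigmaE)
      then show "tensor_eval \<theta> (d k) = pscale a ((\<lambda>(z, y). pscale z (\<theta> y)) k) + G ((\<lambda>(z, y). pscale z (\<theta> y)) k)"
        by (simp add: d_def plinear_add[OF plinear_tensor_eval] g plinear_pscale[OF G])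
    qed
    also have "\<dots> = pscale a (tensor_eval \<theta> p) + G (tensor_eval \<theta> p)"
      by (simp add: lin_ext_plus lin_ext_pscale plinear_lin_ext_comp[OF G] tensor_eval_def)
    finally show "tensor_eval \<theta> (D p) = pscale a (tensor_eval \<theta> p) + G (tensor_eval \<theta> p)" .
  qed
  note * = T.quot_map_coordinates[where f = D and g = "\<lambda>w. pscale a w + G w", OF this X[unfolded tensor_module_eq]]
  have "tensor_act one_dim N (\<lambda>z. a * z) g X = quot_map (free_module (UNIV \<times> carrier N)) T.ker D X"
    unfolding tensor_act_def tensor_kernel_eq D_def carrier_one_dim ..
  with * show "tensor_act one_dim N (\<lambda>z. a * z) g X \<in> carrier (tensor_module one_dim N)"
    "fibre_value (tensor_eval \<theta>) (tensor_act one_dim N (\<lambda>z. a * z) g X) =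
      pscale a (fibre_value (tensor_eval \<theta>) X) + G (fibre_value (tensor_eval \<theta>) X)"
    by (simp_all add: tensor_module_eq)
qed

end

section \<open>Symmetric algebras\<close>

lemma ring_poly_algebra: "ring (poly_algebra V)"
proof -
  interpret linear_map_on pscale "poly_algebra V" "\<lambda>_. 0"
    by (rule linear_map_on_poly_algebra) (simp add: plinear_def)
  have mult: "p * q \<in> carrier (poly_algebra V)"
    if "p \<in> carrier (poly_algebra V)" "q \<in> carrier (poly_algebra V)" for p q
    using that keys_mult[of p q] by (fastforce simp: poly_algebra_def)
  show ?thesis
  proof (rule ringI)
    show "abelian_group (poly_algebra V)" by (rule abelian_group)
    show "monoid (poly_algebra V)"
    proof (rule monoidI)
      show "p \<otimes>\<^bsub>poly_algebra V\<^esub> q \<in> carrier (poly_algebra V)"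
        if "p \<in> carrier (poly_algebra V)" "q \<in> carrier (poly_algebra V)" for p q
        using mult[OF that] by (simp add: poly_algebra_def)
    qed (simp_all add: poly_algebra_def mult.assoc)
  qed (simp_all add: poly_algebra_def distrib_left distrib_right)
qed

lemma ideal_poly_algebraD:
  assumes "ideal J (poly_algebra V)"
  shows "0 \<in> J" "p \<in> J \<Longrightarrow> q \<in> J \<Longrightarrow> p + q \<in> J"
    "q \<in> carrier (poly_algebra V) \<Longrightarrow> p \<in> J \<Longrightarrow> q * p \<in> J"
    "q \<in> carrier (poly_algebra V) \<Longrightarrow> p \<in> J \<Longrightarrow> p * q \<in> J"
    "p \<in> J \<Longrightarrow> pscale c p \<in> J"
    "p \<in> J \<Longrightarrow> q \<in> J \<Longrightarrow> p - q \<in> J"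
proof -
  interpret ideal J "poly_algebra V" by (rule assms)
  show "0 \<in> J" and add: "p \<in> J \<Longrightarrow> q \<in> J \<Longrightarrow> p + q \<in> J" for p q
    using subgroup.one_closed[OF a_subgroup] subgroup.m_closed[OF a_subgroup]
    by (simp_all add: poly_algebra_def)
  show mult: "q \<in> carrier (poly_algebra V) \<Longrightarrow> p \<in> J \<Longrightarrow> q * p \<in> J" for p q
    using I_l_closed by (simp add: poly_algebra_def)
  show "q \<in> carrier (poly_algebra V) \<Longrightarrow> p \<in> J \<Longrightarrow> p * q \<in> J"
    using I_r_closed by (simp add: poly_algebra_def)
  have const: "Poly_Mapping.single 0 c \<in> carrier (poly_algebra V)" for c
    by (simp add: poly_algebra_def)
  show scale: "p \<in> J \<Longrightarrow> pscale c p \<in> J" for p c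
    unfolding pscale_conv_mult by (rule mult[OF const])
  have "pscale (- 1) q = - q" for q :: "'a multiset \<Rightarrow>\<^sub>0 complex"
    by (simp add: poly_mapping_eq_iff fun_eq_iff)
  then show "p \<in> J \<Longrightarrow> q \<in> J \<Longrightarrow> p - q \<in> J"
    using add[of p "- q"] scale[of q "- 1"] by simp
qed

text \<open>
  The image of a vector in the symmetric algebra: the linear polynomial with its entries as
  coefficients.
\<close>

definition linear_form :: "complex^'n \<Rightarrow> ('n multiset \<Rightarrow>\<^sub>0 complex)" where
  "linear_form a = (\<Sum>j\<in>UNIV. Poly_Mapping.single {#j#} (a $ j))"

lemma linear_form_add: "linear_form (a + b) = linear_form a + linear_form b"
  by (simp add: linear_form_def single_add sum.distrib)

lemma linear_form_scale: "linear_form (c *s a) = pscale c (linear_form a)"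
  by (simp add: linear_form_def pscale_sum)

lemma linear_form_axis: "linear_form (axis j 1) = Poly_Mapping.single {#j#} 1"
proof -
  have "linear_form (axis j 1) = (\<Sum>k\<in>UNIV. if j = k then Poly_Mapping.single {#k#} 1 else 0)"
    unfolding linear_form_def by (rule sum.cong) (auto simp: axis_def)
  then show ?thesis by simp
qed

text \<open>
  The iterated Leibniz rule, in the shape of the formula that defines \<open>sym_act\<close>.
\<close>

lemma derivation_prod_mset:
  fixes G :: "('k::comm_monoid_add \<Rightarrow>\<^sub>0 complex) \<Rightarrow> ('k \<Rightarrow>\<^sub>0 complex)"
  assumes lin: "plinear G" and leibniz: "\<And>p q. G (p * q) = G p * q + p * G q"
  shows "G (\<Prod>v\<in>#m. h v) = (\<Sum>v\<in>#m. (\<Prod>x\<in>#m - {#v#}. h x) * G (h v))"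
proof (induction m)
  case empty
  have "G 1 = 0" using leibniz[of 1 1] by simp
  then show ?case by simp
next
  case (add a m)
  have "(\<Prod>x\<in>#add_mset a m - {#v#}. h x) = h a * (\<Prod>x\<in>#m - {#v#}. h x)" if "v \<in># m" for v
  proof -
    obtain n where "m = add_mset v n" using multi_member_split[OF \<open>v \<in># m\<close>] by blast
    then show ?thesis by (simp add: add_mset_commute[of a v])
  qed
  then have "(\<Sum>v\<in>#m. (\<Prod>x\<in>#add_mset a m - {#v#}. h x) * G (h v)) =
      (\<Sum>v\<in>#m. h a * ((\<Prod>x\<in>#m - {#v#}. h x) * G (h v)))"
    by (intro arg_cong[where f = sum_mset] image_mset_cong) (simp add: mult.assoc)
  also have "\<dots> = h a * G (\<Prod>v\<in>#m. h v)"
    by (simp only: add.IH sum_mset_distrib_left)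
  finally have "(\<Sum>v\<in>#m. (\<Prod>x\<in>#add_mset a m - {#v#}. h x) * G (h v)) = h a * G (\<Prod>v\<in>#m. h v)" .
  moreover have "G (\<Prod>v\<in>#add_mset a m. h v) = G (h a) * (\<Prod>v\<in>#m. h v) + h a * G (\<Prod>v\<in>#m. h v)"
    by (simp add: leibniz)
  moreover have "(\<Sum>v\<in>#add_mset a m. (\<Prod>x\<in>#add_mset a m - {#v#}. h x) * G (h v)) =
      (\<Prod>v\<in>#m. h v) * G (h a) + (\<Sum>v\<in>#m. (\<Prod>x\<in>#add_mset a m - {#v#}. h x) * G (h v))"
    by simp
  ultimately show ?case by (simp only: mult.commute)
qed

locale coordinate_space = full_coordinates "(*s)" V \<theta>
  for V and \<theta> :: "'a \<Rightarrow> complex^'n::finite"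
begin

text \<open>
  The algebra homomorphism \<open>X\<^sub>v \<mapsto> linear_form (\<theta> v)\<close> and a right inverse of it, which sends the
  \<open>j\<close>-th indeterminate to \<open>X\<^sub>e\<close> for the \<open>j\<close>-th basis vector \<open>e\<close>.
\<close>

definition poly_eval :: "('a multiset \<Rightarrow>\<^sub>0 complex) \<Rightarrow> ('n multiset \<Rightarrow>\<^sub>0 complex)" where
  "poly_eval = lin_ext (\<lambda>m. \<Prod>v\<in>#m. linear_form (\<theta> v))"

definition poly_lift :: "('n multiset \<Rightarrow>\<^sub>0 complex) \<Rightarrow> ('a multiset \<Rightarrow>\<^sub>0 complex)" where
  "poly_lift = lin_ext (\<lambda>m. Poly_Mapping.single (image_mset (\<lambda>j. elem (axis j 1)) m) 1)"

lemma plinear_poly_eval [simp]: "plinear poly_eval"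
  and plinear_poly_lift [simp]: "plinear poly_lift"
  by (simp_all add: poly_eval_def poly_lift_def)

lemma poly_eval_mult: "poly_eval (p * q) = poly_eval p * poly_eval q"
  unfolding poly_eval_def by (rule lin_ext_mult) simp

lemma poly_lift_mult: "poly_lift (p * q) = poly_lift p * poly_lift q"
  unfolding poly_lift_def by (rule lin_ext_mult) (simp add: mult_single)

lemma poly_eval_single [simp]:
  "poly_eval (Poly_Mapping.single m c) = pscale c (\<Prod>v\<in>#m. linear_form (\<theta> v))"
  by (simp add: poly_eval_def)

lemma poly_lift_mem: "poly_lift p \<in> carrier (poly_algebra (carrier V))"
  using keys_lin_ext[of "\<lambda>m. Poly_Mapping.single (image_mset (\<lambda>j. elem (axis j 1)) m) 1" p]
  unfolding poly_lift_def poly_algebra_def by fastforce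

lemma prod_mset_linear_form_axis: "(\<Prod>j\<in>#m. linear_form (axis j 1)) = Poly_Mapping.single m 1"
  by (induction m) (simp_all add: linear_form_axis mult_single flip: single_one)

lemma poly_eval_lift: "poly_eval (poly_lift p) = p"
  by (simp add: poly_lift_def plinear_lin_ext_comp[OF plinear_poly_eval] image_mset.compositionality
      comp_def prod_mset_linear_form_axis lin_ext_basis)

sublocale S: linear_map_on pscale "poly_algebra (carrier V)" poly_eval
  by (rule linear_map_on_poly_algebra) simp

lemma sym_relations_ker: "sym_relations V \<subseteq> S.ker"
proof
  note lin = plinear_diff[OF plinear_poly_eval]
  have single: "Poly_Mapping.single {#v#} c \<in> carrier (poly_algebra (carrier V))"
    if "v \<in> carrier V" for v c
    using that by (simp add: poly_algebra_def)
  fix p assume "p \<in> sym_relations V"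
  then consider v w where "v \<in> carrier V" "w \<in> carrier V"
      "p = Poly_Mapping.single {#v \<oplus>\<^bsub>V\<^esub> w#} 1 - Poly_Mapping.single {#v#} 1 - Poly_Mapping.single {#w#} 1"
    | c v where "v \<in> carrier V"
      "p = Poly_Mapping.single {#c \<odot>\<^bsub>V\<^esub> v#} 1 - Poly_Mapping.single {#v#} c"
    unfolding sym_relations_def by blast
  then show "p \<in> S.ker"
  proof cases
    case 1
    have "p \<in> carrier (poly_algebra (carrier V))"
      unfolding 1(3) by (intro S.diff_mem single add_closed 1)
    moreover have "poly_eval p = 0"
      by (simp add: 1 lin coord_add linear_form_add)
    ultimately show ?thesis by (simp add: map_ker_def)
  next
    case 2
    have "p \<in> carrier (poly_algebra (carrier V))"
      unfolding 2(2) by (intro S.diff_mem single smult_closed 2)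
    moreover have "poly_eval p = 0"
      by (simp add: 2 lin coord_smult linear_form_scale)
    ultimately show ?thesis by (simp add: map_ker_def)
  qed
qed

lemma ideal_ker: "ideal S.ker (poly_algebra (carrier V))"
proof -
  interpret R: ring "poly_algebra (carrier V)" by (rule ring_poly_algebra)
  have "p \<otimes>\<^bsub>poly_algebra (carrier V)\<^esub> q = p * q" for p q
    by (simp add: poly_algebra_def)
  then show ?thesis
    using R.m_closed
    by (intro idealI R.ring_axioms S.subgroup_ker) (auto simp: map_ker_def poly_eval_mult)
qed

text \<open>
  Both sides of the congruence are algebra homomorphisms in \<open>p\<close>, so it is enough to treat a
  generator \<open>X\<^sub>v\<close>, and this is the expansion of \<open>v\<close> in the basis.
\<close>

lemma reduce_mod_sym_relations:
  assumes J: "ideal J (poly_algebra (carrier V))" and rel: "sym_relations V \<subseteq> J"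
    and p: "p \<in> carrier (poly_algebra (carrier V))"
  shows "p - poly_lift (poly_eval p) \<in> J"
proof -
  note J = ideal_poly_algebraD[OF J]
  have sum_rel: "Poly_Mapping.single {#v \<oplus>\<^bsub>V\<^esub> w#} 1 - Poly_Mapping.single {#v#} 1 - Poly_Mapping.single {#w#} 1 \<in> J"
    if "v \<in> carrier V" "w \<in> carrier V" for v w
    using rel that unfolding sym_relations_def by blast
  have scale_rel: "Poly_Mapping.single {#c \<odot>\<^bsub>V\<^esub> v#} 1 - Poly_Mapping.single {#v#} c \<in> J"
    if "v \<in> carrier V" for c v
    using rel that unfolding sym_relations_def by blast
  let ?e = "\<lambda>j. elem (axis j 1)"
  have expand: "Poly_Mapping.single {#elem (\<Sum>j\<in>A. (a $ j) *s axis j 1)#} 1 -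
      (\<Sum>j\<in>A. Poly_Mapping.single {#?e j#} (a $ j)) \<in> J" if "finite A" for a A
    using that
  proof induction
    case empty
    have "0 \<odot>\<^bsub>V\<^esub> elem 0 = elem 0"
      using elem_scale[of 0 0] by simp
    then show ?case using scale_rel[of "elem 0" 0] by simp
  next
    case (insert j A)
    let ?y = "elem (\<Sum>j\<in>A. (a $ j) *s axis j 1)" and ?x = "elem ((a $ j) *s axis j 1)"
    have x: "Poly_Mapping.single {#?x#} 1 - Poly_Mapping.single {#?e j#} (a $ j) \<in> J"
      using scale_rel[of "?e j" "a $ j"] by (simp add: elem_scale)
    have "Poly_Mapping.single {#?x \<oplus>\<^bsub>V\<^esub> ?y#} 1 -
        (Poly_Mapping.single {#?e j#} (a $ j) + (\<Sum>j\<in>A. Poly_Mapping.single {#?e j#} (a $ j))) =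
      (Poly_Mapping.single {#?x \<oplus>\<^bsub>V\<^esub> ?y#} 1 - Poly_Mapping.single {#?x#} 1 - Poly_Mapping.single {#?y#} 1)
      + (Poly_Mapping.single {#?x#} 1 - Poly_Mapping.single {#?e j#} (a $ j))
      + (Poly_Mapping.single {#?y#} 1 - (\<Sum>j\<in>A. Poly_Mapping.single {#?e j#} (a $ j)))"
      by simp
    also have "\<dots> \<in> J" by (intro J(2) sum_rel x insert.IH elem_mem)
    finally show ?case using insert.hyps by (simp add: elem_add)
  qed
  have generator: "Poly_Mapping.single {#v#} 1 - poly_lift (linear_form (\<theta> v)) \<in> J"
    if "v \<in> carrier V" for v
  proof -
    have "poly_lift (linear_form (\<theta> v)) = (\<Sum>j\<in>UNIV. Poly_Mapping.single {#?e j#} (\<theta> v $ j))"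
      by (simp add: linear_form_def plinear_sum[OF plinear_poly_lift]) (simp add: poly_lift_def)
    then show ?thesis
      using expand[of UNIV "\<theta> v"] that by (simp add: basis_expansion elem_coord)
  qed
  have monomial: "Poly_Mapping.single m 1 - poly_lift (poly_eval (Poly_Mapping.single m 1)) \<in> J"
    if "set_mset m \<subseteq> carrier V" for m
    using that
  proof (induction m)
    case empty
    have "poly_lift 1 = 1" "poly_eval 1 = 1"
      by (simp_all add: poly_lift_def poly_eval_def flip: single_one)
    then show ?case using J(1) by simp
  next
    case (add v m)
    let ?L = "poly_lift (linear_form (\<theta> v))"
    let ?P = "poly_lift (poly_eval (Poly_Mapping.single m 1))"
    have split: "Poly_Mapping.single (add_mset v m) 1 =
        Poly_Mapping.single {#v#} (1::complex) * Poly_Mapping.single m 1"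
      by (simp add: mult_single)
    have "Poly_Mapping.single (add_mset v m) 1 - poly_lift (poly_eval (Poly_Mapping.single (add_mset v m) 1)) =
        Poly_Mapping.single {#v#} 1 * (Poly_Mapping.single m 1 - ?P) + (Poly_Mapping.single {#v#} 1 - ?L) * ?P"
      unfolding split poly_eval_mult poly_lift_mult by (simp add: algebra_simps)
    also have "\<dots> \<in> J"
      using add by (intro J(2) J(3)[OF _ add.IH] J(4)[OF poly_lift_mem generator])
        (auto simp: poly_algebra_def)
    finally show ?case .
  qed
  have "Poly_Mapping.keys p \<subseteq> {m. set_mset m \<subseteq> carrier V}"
    using p by (auto simp: poly_algebra_def)
  then show ?thesis
  proof (induction p rule: poly_mapping_keys_induct)
    case zero
    show ?case using J(1) by (simp add: plinear_0)
  next
    case (single m c)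
    have "Poly_Mapping.single m c = pscale c (Poly_Mapping.single m 1)" by simp
    then show ?case
      using J(5)[OF monomial[of m], of c] single
      by (simp only: plinear_pscale[OF plinear_poly_eval] plinear_pscale[OF plinear_poly_lift]
          pscale_diff mem_Collect_eq)
  next
    case (add p q)
    have "p + q - poly_lift (poly_eval (p + q)) =
        (p - poly_lift (poly_eval p)) + (q - poly_lift (poly_eval q))"
      by (simp add: plinear_add[OF plinear_poly_eval] plinear_add[OF plinear_poly_lift])
    then show ?case using J(2)[OF add.IH] by (simp only:)
  qed
qed

lemma sym_ideal_eq: "sym_ideal V = S.ker"
proof
  show "sym_ideal V \<subseteq> S.ker"
    unfolding sym_ideal_def genideal_def using ideal_ker sym_relations_ker by blast
  show "S.ker \<subseteq> sym_ideal V"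
  proof
    fix p assume "p \<in> S.ker"
    then have "p \<in> carrier (poly_algebra (carrier V))" "poly_eval p = 0"
      by (simp_all add: map_ker_def)
    then have "p \<in> J" if "ideal J (poly_algebra (carrier V))" "sym_relations V \<subseteq> J" for J
      using reduce_mod_sym_relations[OF that] by (force simp: plinear_0)
    then show "p \<in> sym_ideal V"
      by (simp add: sym_ideal_def genideal_def)
  qed
qed

lemma sym_algebra_eq: "sym_algebra V = quot_module (poly_algebra (carrier V)) S.ker"
  by (simp add: sym_algebra_def sym_ideal_eq)

lemma full_coordinates_sym: "full_coordinates pscale (sym_algebra V) (fibre_value poly_eval)"
proof -
  have onto: "w \<in> poly_eval ` carrier (poly_algebra (carrier V))" for w
    using poly_eval_lift[of w] poly_lift_mem[of w] by (metis imageI)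
  show ?thesis
    unfolding sym_algebra_eq
    by (intro full_coordinates.intro full_coordinates_axioms.intro S.coordinates_quot)
      (simp only: S.fibre_value_image UNIV_eq_I[OF onto, symmetric])
qed

text \<open>
  A derivation is determined by its values on linear forms, so it is enough that \<open>G\<close> and \<open>f\<close>
  agree there.
\<close>

lemma sym_act_coordinates:
  assumes f: "\<And>v. v \<in> carrier V \<Longrightarrow> f v \<in> carrier V \<and> linear_form (\<theta> (f v)) = G (linear_form (\<theta> v))"
    and G: "plinear G" and leibniz: "\<And>p q. G (p * q) = G p * q + p * G q"
    and X: "X \<in> carrier (sym_algebra V)"
  shows "sym_act V f X \<in> carrier (sym_algebra V)"
    and "fibre_value poly_eval (sym_act V f X) = G (fibre_value poly_eval X)"
proof -
  define D where "D p = (\<Sum>m\<in>Poly_Mapping.keys p. \<Sum>v\<in>#m.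
      Poly_Mapping.single (m - {#v#} + {#f v#}) (Poly_Mapping.lookup p m))" for p :: "'a multiset \<Rightarrow>\<^sub>0 complex"
  define d where "d m = (\<Sum>v\<in>#m. Poly_Mapping.single (m - {#v#} + {#f v#}) (1::complex))" for m
  have D: "D = lin_ext d"
    by (simp add: fun_eq_iff D_def d_def lin_ext_def pscale_sum_mset)
  have "D p \<in> carrier (poly_algebra (carrier V)) \<and> poly_eval (D p) = G (poly_eval p)"
    if p: "p \<in> carrier (poly_algebra (carrier V))" for p
  proof
    have d_mem: "d m \<in> carrier (poly_algebra (carrier V))" if m: "set_mset m \<subseteq> carrier V" for m
    proof -
      have "(\<Sum>v\<in>#n. Poly_Mapping.single (m - {#v#} + {#f v#}) (1::complex)) \<in> carrier (poly_algebra (carrier V))"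
        if "set_mset n \<subseteq> carrier V" for n
        using that
      proof (induction n)
        case empty
        show ?case by (simp add: S.zero_mem)
      next
        case (add v n)
        have "Poly_Mapping.single (m - {#v#} + {#f v#}) (1::complex) \<in> carrier (poly_algebra (carrier V))"
          using add.prems m f by (auto simp: poly_algebra_def dest: in_diffD)
        with add show ?case by (simp add: S.add_mem)
      qed
      then show ?thesis using m by (simp add: d_def)
    qed
    have "Poly_Mapping.keys (d m) \<subseteq> {n. set_mset n \<subseteq> carrier V}" if "m \<in> Poly_Mapping.keys p" for m
      using d_mem[of m] p that by (auto simp: poly_algebra_def)
    then show "D p \<in> carrier (poly_algebra (carrier V))"
      using keys_lin_ext[of d p] unfolding D by (fastforce simp: poly_algebra_def)
    have "poly_eval (D p) = lin_ext (\<lambda>m. poly_eval (d m)) p"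
      unfolding D by (rule plinear_lin_ext_comp) simp
    also have "\<dots> = lin_ext (\<lambda>m. G (\<Prod>v\<in>#m. linear_form (\<theta> v))) p"
    proof (rule lin_ext_cong)
      fix m assume "m \<in> Poly_Mapping.keys p"
      then have m: "set_mset m \<subseteq> carrier V" using p by (auto simp: poly_algebra_def)
      have "poly_eval (d m) = (\<Sum>v\<in>#m. (\<Prod>x\<in>#m - {#v#}. linear_form (\<theta> x)) * linear_form (\<theta> (f v)))"
        by (simp add: d_def plinear_sum_mset[OF plinear_poly_eval] mult.commute)
      also have "\<dots> = (\<Sum>v\<in>#m. (\<Prod>x\<in>#m - {#v#}. linear_form (\<theta> x)) * G (linear_form (\<theta> v)))"
        using m f by (intro arg_cong[where f = sum_mset] image_mset_cong) auto
      also have "\<dots> = G (\<Prod>v\<in>#m. linear_form (\<theta> v))"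
        by (rule derivation_prod_mset[OF G leibniz, symmetric])
      finally show "poly_eval (d m) = G (\<Prod>v\<in>#m. linear_form (\<theta> v))" .
    qed
    also have "\<dots> = G (poly_eval p)"
      unfolding poly_eval_def by (rule plinear_lin_ext_comp[OF G, symmetric])
    finally show "poly_eval (D p) = G (poly_eval p)" .
  qed
  note * = S.quot_map_coordinates[where f = D and g = G, OF this X[unfolded sym_algebra_eq]]
  have "sym_act V f X = quot_map (poly_algebra (carrier V)) S.ker D X"
    unfolding sym_act_def sym_ideal_eq D_def ..
  with * show "sym_act V f X \<in> carrier (sym_algebra V)"
    "fibre_value poly_eval (sym_act V f X) = G (fibre_value poly_eval X)"
    by (simp_all add: sym_algebra_eq)
qed

end

section \<open>Homomorphisms out of a line\<close>

lemma (in coordinates) module_dim_zero: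
  assumes "\<And>x. x \<in> carrier M \<Longrightarrow> \<theta> x = 0"
  shows "module_dim M = 0"
proof -
  interpret abelian_monoid M by (rule abelian_monoid)
  have "x = \<zero>" if "x \<in> carrier M" for x
    using that by (intro coord_eqI) (simp_all add: assms)
  then have "finite_basis M {}" by (simp add: finite_basis_def)
  then have "module_dim M \<le> enat 0"
    unfolding module_dim_def by (intro Inf_lower CollectI exI[of _ "{}"]) simp
  then show ?thesis by (simp flip: zero_enat_def)
qed

text \<open>
  The coordinates of all linear combinations of a finite set are supported in the union of the
  supports of its members, which is finite.
\<close>

lemma module_dim_infinite:
  assumes "coordinates pscale M \<theta>"
    and inf: "infinite (\<Union>x\<in>carrier M. Poly_Mapping.keys (\<theta> x))"
  shows "module_dim M = \<infinity>"
proof -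
  interpret coordinates pscale M \<theta> by (rule assms)
  have "\<not> finite_basis M B" for B
  proof
    assume B: "finite_basis M B"
    have "Poly_Mapping.keys (\<theta> x) \<subseteq> (\<Union>b\<in>B. Poly_Mapping.keys (\<theta> b))" if x: "x \<in> carrier M" for x
    proof -
      obtain c where c: "x = (\<Oplus>\<^bsub>M\<^esub>b\<in>B. c b \<odot>\<^bsub>M\<^esub> b)"
        using B x unfolding finite_basis_def by blast
      have "\<theta> x = (\<Sum>b\<in>B. \<theta> (c b \<odot>\<^bsub>M\<^esub> b))"
        unfolding c using B by (intro coord_finsum) (auto simp: finite_basis_def smult_closed)
      also have "\<dots> = (\<Sum>b\<in>B. pscale (c b) (\<theta> b))"
        using B by (intro sum.cong) (auto simp: finite_basis_def coord_smult)
      finally show ?thesis using keys_sum keys_pscale by fastforce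
    qed
    then have "(\<Union>x\<in>carrier M. Poly_Mapping.keys (\<theta> x)) \<subseteq> (\<Union>b\<in>B. Poly_Mapping.keys (\<theta> b))"
      by blast
    moreover have "finite (\<Union>b\<in>B. Poly_Mapping.keys (\<theta> b))"
      using B by (simp add: finite_basis_def)
    ultimately show False using inf finite_subset by blast
  qed
  then show ?thesis by (simp add: module_dim_def Inf_enat_def)
qed

context line_tensor
begin

context
  fixes L :: "'l set" and \<psi> :: "'l \<Rightarrow> complex" and \<sigma> :: "'l \<Rightarrow> 'b \<Rightarrow> 'b"
    and A :: "'l \<Rightarrow> ('k \<Rightarrow>\<^sub>0 complex) \<Rightarrow> ('k \<Rightarrow>\<^sub>0 complex)"
  assumes \<sigma>: "\<And>h y. h \<in> L \<Longrightarrow> y \<in> carrier N \<Longrightarrow> \<sigma> h y \<in> carrier N \<and> \<theta> (\<sigma> h y) = A h (\<theta> y)"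
    and A: "\<And>h. h \<in> L \<Longrightarrow> plinear (A h)"
begin

abbreviation "homs \<equiv> hom_module L one_dim (char_act \<psi>) N \<sigma>"

abbreviation "eigenvectors \<equiv> {w. \<forall>h\<in>L. A h w = pscale (\<psi> h) w}"

abbreviation line_map :: "('k \<Rightarrow>\<^sub>0 complex) \<Rightarrow> complex \<Rightarrow> 'b" where
  "line_map w \<equiv> \<lambda>z. elem (pscale z w)"

text \<open>
  A linear map out of the line is determined by the image of \<open>1\<close>, and it is equivariant precisely
  when that image is an eigenvector.
\<close>

lemma equivariant_line_map_iff:
  "h \<in> L \<Longrightarrow> (\<forall>z. line_map w (\<psi> h * z) = \<sigma> h (line_map w z)) \<longleftrightarrow> A h w = pscale (\<psi> h) w"
proof
  assume h: "h \<in> L"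
  show "A h w = pscale (\<psi> h) w" if eq: "\<forall>z. line_map w (\<psi> h * z) = \<sigma> h (line_map w z)"
  proof -
    have "A h w = \<theta> (\<sigma> h (line_map w 1))"
      using \<sigma>[OF h, of "line_map w 1"] by simp
    also have "\<dots> = \<theta> (line_map w (\<psi> h * 1))" by (simp only: spec[OF eq, of 1])
    finally show ?thesis by simp
  qed
  show "\<forall>z. line_map w (\<psi> h * z) = \<sigma> h (line_map w z)" if "A h w = pscale (\<psi> h) w"
  proof
    fix z
    show "line_map w (\<psi> h * z) = \<sigma> h (line_map w z)"
      using \<sigma>[OF h, of "line_map w z"] that plinear_pscale[OF A[OF h]]
      by (intro coord_eqI) (simp_all add: mult.commute)
  qed
qed

lemma carrier_homs: "carrier homs = line_map ` eigenvectors"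
proof (intro equalityI subsetI)
  fix F assume "F \<in> carrier homs"
  then have F: "F z \<in> carrier N" "F (c * z) = c \<odot>\<^bsub>N\<^esub> F z"
    and equi: "h \<in> L \<Longrightarrow> F (\<psi> h * z) = \<sigma> h (F z)" for c z h
    by (auto simp: hom_module_def char_act_def Pi_iff)
  have F_eq: "F = line_map (\<theta> (F 1))"
  proof
    fix z
    have "\<theta> (F z) = pscale z (\<theta> (F 1))"
      using F(2)[of z 1] by (simp add: F(1) coord_smult)
    then show "F z = line_map (\<theta> (F 1)) z"
      by (intro coord_eqI) (simp_all add: F(1))
  qed
  have "A h (\<theta> (F 1)) = pscale (\<psi> h) (\<theta> (F 1))" if h: "h \<in> L" for h
  proof -
    have "\<theta> (F (\<psi> h)) = pscale (\<psi> h) (\<theta> (F 1))"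
      using F(2)[of "\<psi> h" 1] by (simp add: F(1) coord_smult)
    then show ?thesis using equi[OF h, of 1] \<sigma>[OF h F(1)[of 1]] by simp
  qed
  then show "F \<in> line_map ` eigenvectors" using F_eq by blast
next
  fix F assume "F \<in> line_map ` eigenvectors"
  then obtain w where w: "w \<in> eigenvectors" "F = line_map w" by blast
  then have "\<forall>h\<in>L. \<forall>z. F (\<psi> h * z) = \<sigma> h (F z)" using equivariant_line_map_iff by blast
  moreover have "F (y + z) = F y \<oplus>\<^bsub>N\<^esub> F z" "F (c * z) = c \<odot>\<^bsub>N\<^esub> F z" for y z c
    by (simp_all add: w(2) pscale_add_left elem_add flip: elem_scale)
  ultimately show "F \<in> carrier homs"
    by (auto simp: hom_module_def char_act_def w(2))
qed

lemma coordinates_homs: "coordinates pscale homs (\<lambda>F. \<theta> (F 1))"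
proof -
  have zero: "\<zero>\<^bsub>homs\<^esub> = line_map 0"
    by (simp add: hom_module_def elem_zero restrict_def)
  have add: "line_map w \<oplus>\<^bsub>homs\<^esub> line_map w' = line_map (w + w')" for w w'
    by (simp add: hom_module_def restrict_def pscale_add elem_add)
  have smult: "c \<odot>\<^bsub>homs\<^esub> line_map w = line_map (pscale c w)" for c w
    by (simp add: hom_module_def restrict_def mult.commute flip: elem_scale)
  have mem: "line_map w \<in> carrier homs" if "w \<in> eigenvectors" for w
    unfolding carrier_homs using that by (rule imageI)
  show ?thesis
  proof
    show "inj_on (\<lambda>F. \<theta> (F 1)) (carrier homs)"
      unfolding carrier_homs by (rule inj_onI) force
    show "\<zero>\<^bsub>homs\<^esub> \<in> carrier homs" "\<theta> (\<zero>\<^bsub>homs\<^esub> 1) = 0"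
      unfolding zero by (rule mem) (simp_all add: plinear_0 A)
    fix F G c assume "F \<in> carrier homs"
    then obtain w where w: "w \<in> eigenvectors" and F: "F = line_map w" unfolding carrier_homs by (rule imageE)
    show "c \<odot>\<^bsub>homs\<^esub> F \<in> carrier homs" "\<theta> ((c \<odot>\<^bsub>homs\<^esub> F) 1) = pscale c (\<theta> (F 1))"
      unfolding F smult by (rule mem) (use w in \<open>simp_all add: plinear_pscale A mult.commute\<close>)
    assume "G \<in> carrier homs"
    then obtain w' where w': "w' \<in> eigenvectors" and G: "G = line_map w'" unfolding carrier_homs by (rule imageE)
    show "F \<oplus>\<^bsub>homs\<^esub> G \<in> carrier homs" "\<theta> ((F \<oplus>\<^bsub>homs\<^esub> G) 1) = \<theta> (F 1) + \<theta> (G 1)"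
      unfolding F G add by (rule mem) (use w w' in \<open>simp_all add: plinear_add A pscale_add\<close>)
  qed
qed

lemma homs_coords: "(\<lambda>F. \<theta> (F 1)) ` carrier homs = eigenvectors"
  unfolding carrier_homs by (simp add: image_image)

end

end


section \<open>The quotient of the lower triangular matrices\<close>

text \<open>
  The second coordinate depends on \<open>i\<close> so that in both cases the first basis vector has
  eigenvalue \<open>-1\<close> and the second has eigenvalue \<open>1\<close> under the generator of \<open>\<aa>'\<^sub>i\<close>.
\<close>

definition nq_coord :: "nat \<Rightarrow> complex^3^3 \<Rightarrow> complex^2" where
  "nq_coord i X = (\<chi> j. if j = 1 then X$3$1 else if i = 1 then X$3$2 else X$2$1)"

lemma carrier_n_minus: "carrier (vspace_on cscale n_minus) = n_minus"
  by (simp add: vspace_on_def)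

lemma linear_map_nq_coord: "linear_map_on (*s) (vspace_on cscale n_minus) (nq_coord i)"
  by unfold_locales
    (simp_all add: vspace_on_def n_minus_iff cscale_def nq_coord_def vec_eq_iff)

lemma ker_nq_coord:
  assumes "i \<in> {1, 2}"
  shows "map_ker (vspace_on cscale n_minus) (nq_coord i) = n'_minus i"
proof (intro equalityI subsetI)
  fix X assume "X \<in> map_ker (vspace_on cscale n_minus) (nq_coord i)"
  then have X: "X \<in> n_minus" "X$3$1 = 0" "(if i = 1 then X$3$2 else X$2$1) = 0"
    by (auto simp: map_ker_def carrier_n_minus nq_coord_def vec_eq_iff forall_2)
  define Y :: "complex^2^2" where
    "Y = vector [vector [0, 0], vector [if i = 1 then X$2$1 else X$3$2, 0]]"
  have "X = iota i Y"
    using X assms by (auto simp: vec_eq_iff forall_3 iota_def Y_def n_minus_iff vector_3)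
  moreover have "Y \<in> sl2"
    by (simp add: sl2_def trace_def sum_2 Y_def)
  ultimately show "X \<in> n'_minus i" using X by (auto simp: n'_minus_def g'_sl_def)
next
  fix X assume "X \<in> n'_minus i"
  then obtain Y where "X \<in> n_minus" "X = iota i Y" by (auto simp: n'_minus_def g'_sl_def)
  then show "X \<in> map_ker (vspace_on cscale n_minus) (nq_coord i)"
    using assms
    by (auto simp: map_ker_def carrier_n_minus nq_coord_def vec_eq_iff forall_2 n_minus_iff iota_def vector_3)
qed

abbreviation nq_weight :: "2 \<Rightarrow> complex" where
  "nq_weight j \<equiv> if j = 1 then - 1 else 1"

lemma coordinate_space_n_quot:
  assumes i: "i \<in> {1, 2}"
  shows "coordinate_space (n_quot i) (fibre_value (nq_coord i))"
proof -
  interpret linear_map_on "(*s)" "vspace_on cscale n_minus" "nq_coord i"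
    by (rule linear_map_nq_coord)
  have "w \<in> nq_coord i ` n_minus" for w
  proof
    let ?X = "vector [vector [0, 0, 0], vector [w$2, 0, 0], vector [w$1, w$2, 0]] :: complex^3^3"
    show "?X \<in> n_minus" by (simp add: n_minus_iff vector_3)
    show "w = nq_coord i ?X" by (simp add: nq_coord_def vec_eq_iff forall_2 vector_3)
  qed
  then have onto: "nq_coord i ` n_minus = UNIV" by blast
  show ?thesis
    unfolding n_quot_def ker_nq_coord[OF i, symmetric]
    by (intro coordinate_space.intro full_coordinates.intro full_coordinates_axioms.intro
        coordinates_quot)
      (simp add: fibre_value_image carrier_n_minus onto)
qed

lemma ad_nq_coord:
  assumes "i \<in> {1, 2}" and X: "X \<in> n_minus"
    and H: "H = cscale z (iota i (Emat 1 1 - Emat 2 2))"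
  shows "ad H X \<in> n_minus"
    and "nq_coord i (ad H X) = (\<chi> j. z * nq_weight j * nq_coord i X $ j)"
  using assms(1) X unfolding H
  by (auto simp: n_minus_iff ad_def matrix_matrix_mult_def sum_3 iota_def cscale_def Emat_def vector_3
      nq_coord_def vec_eq_iff forall_2 algebra_simps)

lemma n_quot_act_coordinates:
  assumes i: "i \<in> {1, 2}" and H: "H = cscale z (iota i (Emat 1 1 - Emat 2 2))"
    and X: "X \<in> carrier (n_quot i)"
  shows "n_quot_act i H X \<in> carrier (n_quot i)"
    and "fibre_value (nq_coord i) (n_quot_act i H X) =
      (\<chi> j. z * nq_weight j * fibre_value (nq_coord i) X $ j)"
proof -
  interpret linear_map_on "(*s)" "vspace_on cscale n_minus" "nq_coord i"
    by (rule linear_map_nq_coord)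
  note * = quot_map_coordinates[where f = "ad H" and X = X
      and g = "\<lambda>a. \<chi> j. z * nq_weight j * a $ j", unfolded ker_nq_coord[OF i]]
  show "n_quot_act i H X \<in> carrier (n_quot i)"
    and "fibre_value (nq_coord i) (n_quot_act i H X) =
      (\<chi> j. z * nq_weight j * fibre_value (nq_coord i) X $ j)"
    unfolding n_quot_act_def n_quot_def
    by (rule *; use ad_nq_coord[OF i _ H] X in \<open>simp add: carrier_n_minus n_quot_def\<close>)+
qed

lemma weight_derivation_linear_form:
  "weight_derivation w (linear_form a) = linear_form (\<chi> j. w j * a $ j)"
  unfolding linear_form_def plinear_sum[OF plinear_weight_derivation]
  by (simp add: weight_derivation_def mult.commute)


section \<open>The multiplicity is zero or infinite\<close>

theorem theoremL:
  fixes i :: nat and u :: "complex^2" and v :: complex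
  assumes "i \<in> {1, 2}"
  shows "m_sl i v u \<noteq> 0 \<longleftrightarrow> m_sl i v u = \<infinity>"
proof -
  let ?H = "\<lambda>z. cscale z (iota i (Emat 1 1 - Emat 2 2))"
  \<comment> \<open>The value of the character \<open>u\<close> on the generator of \<open>\<aa>'\<^sub>i\<close>.\<close>
  define l where "l = (if i = 1 then u$1 else u$2)"
  define wt :: "2 multiset \<Rightarrow> complex" where "wt m = (\<Sum>j\<in>#m. nq_weight j)" for m
  interpret V: coordinate_space "n_quot i" "fibre_value (nq_coord i)"
    by (rule coordinate_space_n_quot[OF assms])
  interpret S: line_tensor "sym_algebra (n_quot i)" "fibre_value V.poly_eval"
    by (intro line_tensor.intro V.full_coordinates_sym)
  let ?T = "tensor_module one_dim (sym_algebra (n_quot i))"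
  let ?\<theta> = "fibre_value (tensor_eval (fibre_value V.poly_eval))"
  let ?act = "\<lambda>H. tensor_act one_dim (sym_algebra (n_quot i))
      (char_act (char_sl u) H) (sym_act (n_quot i) (n_quot_act i H))"
  interpret T: line_tensor ?T ?\<theta>
    by (intro line_tensor.intro S.full_coordinates_tensor)
  \<comment> \<open>For \<open>H\<close> equal to \<open>z\<close> times the generator of \<open>\<aa>'\<^sub>i\<close>, the number \<open>char_sl' i 1 H\<close> is \<open>z\<close>.\<close>
  define A where "A H = (\<lambda>w. pscale (char_sl u H) w +
      weight_derivation (\<lambda>j. char_sl' i 1 H * nq_weight j) w)" for H
  have chars: "char_sl u (?H z) = l * z" "char_sl' i c (?H z) = c * z" for z c
    using assms by (auto simp: char_sl_def char_sl'_def l_def iota_def cscale_def Emat_def vector_3)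
  have act: "?act H t \<in> carrier ?T \<and> ?\<theta> (?act H t) = A H (?\<theta> t)"
    if H: "H \<in> a'_sl i" and t: "t \<in> carrier ?T" for H t
  proof -
    obtain z where z: "H = ?H z" using H by (auto simp: a'_sl_def)
    define D where "D = weight_derivation (\<lambda>j. z * nq_weight j)"
    have D: "plinear D" "D (p * q) = D p * q + p * D q" for p q
      unfolding D_def by (rule plinear_weight_derivation weight_derivation_mult)+
    have "n_quot_act i H x \<in> carrier (n_quot i) \<and>
        linear_form (fibre_value (nq_coord i) (n_quot_act i H x)) = D (linear_form (fibre_value (nq_coord i) x))"
      if "x \<in> carrier (n_quot i)" for x
      using n_quot_act_coordinates[OF assms z that] by (simp add: D_def weight_derivation_linear_form)
    note sym = V.sym_act_coordinates[where f = "n_quot_act i H" and G = D, OF this D]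
    have "char_act (char_sl u) H = (\<lambda>x. char_sl u H * x)" by (simp add: char_act_def fun_eq_iff)
    then show ?thesis
      using S.tensor_act_coordinates[where g = "sym_act (n_quot i) (n_quot_act i H)" and G = D
          and a = "char_sl u H" and X = t, OF conjI[OF sym] D(1) t]
      by (simp add: A_def D_def z chars)
  qed
  have A: "plinear (A H)" for H
    unfolding plinear_def A_def
    by (simp add: plinear_add[OF plinear_weight_derivation] plinear_pscale[OF plinear_weight_derivation]
        pscale_add mult.commute add_ac)
  let ?\<phi> = "\<lambda>F. ?\<theta> (F 1)"
  let ?M = "hom_module (a'_sl i) one_dim (char_act (char_sl' i v)) ?T ?act"
  have coords: "coordinates pscale ?M ?\<phi>"
    by (rule T.coordinates_homs[OF act A])
  have lookup: "A (?H z) w = pscale (char_sl' i v (?H z)) w \<longleftrightarrow>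
      (\<forall>m\<in>Poly_Mapping.keys w. z * (l + wt m) = z * v)" for z w
  proof -
    have "Poly_Mapping.lookup (A (?H z) w) m = z * (l + wt m) * Poly_Mapping.lookup w m" for m
      by (simp add: A_def chars lookup_add lookup_weight_derivation wt_def algebra_simps
          flip: sum_mset_distrib_left)
    then show ?thesis
      by (auto simp: poly_mapping_eq_iff fun_eq_iff chars in_keys_iff mult.commute)
  qed
  have eigen: "?\<phi> ` carrier ?M = {w. \<forall>m\<in>Poly_Mapping.keys w. l + wt m = v}"
  proof -
    have "?\<phi> ` carrier ?M = {w. \<forall>h\<in>a'_sl i. A h w = pscale (char_sl' i v h) w}"
      by (rule T.homs_coords[OF act A])
    also have "\<dots> = {w. \<forall>z. \<forall>m\<in>Poly_Mapping.keys w. z * (l + wt m) = z * v}"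
      unfolding lookup[symmetric] by (auto simp: a'_sl_def)
    also have "\<dots> = {w. \<forall>m\<in>Poly_Mapping.keys w. l + wt m = v}"
      by (metis mult_1)
    finally show ?thesis .
  qed
  have "m_sl i v u = 0 \<or> m_sl i v u = \<infinity>"
  proof (cases "\<exists>m. l + wt m = v")
    case False
    have "?\<phi> F = 0" if "F \<in> carrier ?M" for F
    proof -
      have "Poly_Mapping.keys (?\<phi> F) = {}" using imageI[OF that, of ?\<phi>] False unfolding eigen by blast
      then show ?thesis by simp
    qed
    then show ?thesis
      using coordinates.module_dim_zero[OF coords] by (simp add: m_sl_def)
  next
    case True
    then obtain m where m: "l + wt m = v" by blast
    \<comment> \<open>The monomial \<open>X\<^sub>1 X\<^sub>2\<close> is invariant, so multiplication by its powers keeps the eigenvalue.\<close>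
    have shift: "wt (repeat_mset n {#1, 2#} + m) = wt m" for n
      by (induction n) (simp_all add: wt_def)
    have mem: "Poly_Mapping.single (repeat_mset n {#1, 2#} + m) 1 \<in> ?\<phi> ` carrier ?M" for n
      unfolding eigen using m shift[of n] by simp
    have "range (\<lambda>n. repeat_mset n {#1, 2#} + m) \<subseteq> (\<Union>F\<in>carrier ?M. Poly_Mapping.keys (?\<phi> F))"
    proof (rule image_subsetI)
      fix n :: nat
      from mem[of n] obtain F where "Poly_Mapping.single (repeat_mset n {#1, 2#} + m) 1 = ?\<phi> F"
        and F: "F \<in> carrier ?M"
        by (rule imageE)
      then have "repeat_mset n {#1, 2#} + m \<in> Poly_Mapping.keys (?\<phi> F)"
        by (metis keys_single one_neq_zero singletonI)
      with F show "repeat_mset n {#1, 2#} + m \<in> (\<Union>F\<in>carrier ?M. Poly_Mapping.keys (?\<phi> F))"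
        by (intro UN_I[of F])
    qed
    moreover have "infinite (range (\<lambda>n. repeat_mset n {#1, 2#} + m))"
    proof (rule range_inj_infinite, rule injI)
      fix k n assume "repeat_mset k {#1, 2#} + m = repeat_mset n {#1, 2#} + m"
      then have "repeat_mset k {#1, 2#} = repeat_mset n {#1, 2::2#}" by (rule add_right_imp_eq)
      then have "size (repeat_mset k {#1, 2::2#}) = size (repeat_mset n {#1, 2::2#})" by (rule arg_cong)
      then show "k = n" by simp
    qed
    ultimately have "infinite (\<Union>F\<in>carrier ?M. Poly_Mapping.keys (?\<phi> F))"
      by (rule infinite_super)
    then show ?thesis
      using module_dim_infinite[OF coords] by (simp add: m_sl_def)
  qed
  then show ?thesis by auto
qed

end
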